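(* Let $\mathbb{F}_\theta^+$ be an aperiodic single vertex $k$-graph with the little pull-back property. Let $\mathcal{A}$ be a unital C*-subalgebra of $\mathcal{O}_\theta$ such that $\mathcal{X}_0\subset\mathcal{A}$. Then $\mathcal{A}$ is simple and has the Dixmier property.
   Context: A single vertex $k$-graph $\Lambda=\mathbb{F}_\theta^+$ is a monoid (a small category with one object) with a degree homomorphism $d:\Lambda\to\mathbb{N}^k$ satisfying the factorization property: whenever $d(\lambda)=p+q$ with $p,q\in\mathbb{N}^k$, there are unique $\mu,\nu\in\Lambda$ with $\lambda=\mu\nu$, $d(\mu)=p$, $d(\nu)=q$. Let $\epsilon_1,\ldots,\epsilon_k$ be the standard generators of $\mathbb{Z}^k$. The elements of degree $\epsilon_i$ are the edges $e^i_1,\ldots,e^i_{m_i}$, finitely many; for $i<j$ the relations $e^i_{s}e^j_{t}=e^j_{t'}e^i_{s'}$ define permutations $\theta_{ij}(s,t)=(s',t')$. Little pull-back property: for edges $e,f$ of distinct degrees, $|\Lambda^{\min}(e,f)|\le 1$, where $\Lambda^{\min}(\mu,\nu)=\{(\xi,\eta)\in\Lambda\times\Lambda:\mu\xi=\nu\eta,\ d(\mu\xi)=d(\mu)\vee d(\nu)\}$ and $\vee$ is the coordinatewise maximum. A tuple $(V_1,\ldots,V_n)$ in a unital C*-algebra is of Cuntz-type if $V_i^*V_j=\delta_{i,j}I$ and $\sum_iV_iV_i^*=I$. A Cuntz-type representation of $\mathbb{F}_\theta^+$ consists of Cuntz-type tuples $E^i=(E^i_1,\ldots,E^i_{m_i})$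 ($1\le i\le k$) satisfying $E^i_sE^j_t=E^j_{t'}E^i_{s'}$ whenever $i<j$ and $\theta_{ij}(s,t)=(s',t')$. $\mathcal{O}_\theta$ is the universal C*-algebra for Cuntz-type representations, with generators $s_{e^i_t}$, and $s_w$ denotes the product of generators along a word $w$. $\mathbb{F}_\theta^+$ is aperiodic if and only if $\mathcal{O}_\theta$ is simple (this may be taken as the definition). $\mathcal{X}_0=\operatorname{span}\{s_us_v^*:u,v\in\mathbb{F}_\theta^+,\ d(u)=d(v)\}$ (algebraic span). For a unital C*-algebra $\mathcal{A}$ with unitary group $\mathcal{U}(\mathcal{A})$ and centre $\mathcal{Z}(\mathcal{A})$, $\mathsf{Ave}(\mathcal{A},\mathcal{U}(\mathcal{A}))$ is the set of all maps $\alpha(A)=\sum_{i=1}^n\lambda_iU_iAU_i^*$ with $n\ge 1$, $U_i\in\mathcal{U}(\mathcal{A})$, $\lambda_i>0$, $\sum_i\lambda_i=1$. $\mathcal{A}$ has the Dixmier property if for every $A\in\mathcal{A}$ the norm closure of $\{\alpha(A):\alpha\in\mathsf{Ave}(\mathcal{A},\mathcal{U}(\mathcal{A}))\}$ intersects $\mathcal{Z}(\mathcal{A})$. *)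

theory Defs
  imports "HOL-Analysis.Analysis" "HOL-Algebra.Ring"
begin

section \<open>Unital C*-algebras\<close>

text \<open>Two renderings are used. A type of class \<open>cstar_algebra\<close> is a (nonzero) unital C*-algebra
  whose elements are all elements of the type; \<open>\<O>\<^sub>\<theta>\<close> and its subalgebras live in such a type, so that
  the norm topology is the one of the library. Universal properties quantify over all C*-algebras,
  which is not possible with types; for this purpose \<open>cstar_algebra_on\<close> describes a
  C*-algebra with an explicit carrier set, extending the rings of HOL-Algebra.\<close>

class cstar_algebra = real_normed_algebra_1 + banach +
  fixes scaleC :: "complex \<Rightarrow> 'a \<Rightarrow> 'a"  (infixr \<open>*\<^sub>C\<close> 75)
    and adj :: "'a \<Rightarrow> 'a"
  assumes scaleC_add_right: "c *\<^sub>C (x + y) = c *\<^sub>C x + c *\<^sub>C y"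
    and scaleC_add_left: "(b + c) *\<^sub>C x = b *\<^sub>C x + c *\<^sub>C x"
    and scaleC_scaleC: "b *\<^sub>C (c *\<^sub>C x) = (b * c) *\<^sub>C x"
    and scaleR_scaleC: "scaleR r x = complex_of_real r *\<^sub>C x"
    and mult_scaleC_left: "(c *\<^sub>C x) * y = c *\<^sub>C (x * y)"
    and mult_scaleC_right: "x * (c *\<^sub>C y) = c *\<^sub>C (x * y)"
    and norm_scaleC: "norm (c *\<^sub>C x) = cmod c * norm x"
    and adj_add: "adj (x + y) = adj x + adj y"
    and adj_scaleC: "adj (c *\<^sub>C x) = cnj c *\<^sub>C adj x"
    and adj_mult: "adj (x * y) = adj y * adj x"
    and adj_adj: "adj (adj x) = x"
    and cstar_identity: "norm (adj x * x) = (norm x)\<^sup>2"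

global_interpretation cspace: vector_space "scaleC :: complex \<Rightarrow> 'a \<Rightarrow> 'a::cstar_algebra"
proof
  fix x :: 'a
  show "1 *\<^sub>C x = x" using scaleR_scaleC[of 1 x] by simp
qed (auto simp: scaleC_add_right scaleC_add_left scaleC_scaleC)

record 'b cstar = "'b ring" +
  cscale :: "complex \<Rightarrow> 'b \<Rightarrow> 'b"
  cadj :: "'b \<Rightarrow> 'b"
  cnorm :: "'b \<Rightarrow> real"

locale cstar_algebra_on = ring B for B :: "'b cstar" (structure) +
  assumes cscale_closed: "x \<in> carrier B \<Longrightarrow> cscale B c x \<in> carrier B"
    and cadj_closed: "x \<in> carrier B \<Longrightarrow> cadj B x \<in> carrier B"
    and cscale_add_right: "\<lbrakk>x \<in> carrier B; y \<in> carrier B\<rbrakk> \<Longrightarrow>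
          cscale B c (x \<oplus> y) = cscale B c x \<oplus> cscale B c y"
    and cscale_add_left: "x \<in> carrier B \<Longrightarrow> cscale B (b + c) x = cscale B b x \<oplus> cscale B c x"
    and cscale_cscale: "x \<in> carrier B \<Longrightarrow> cscale B b (cscale B c x) = cscale B (b * c) x"
    and cscale_one: "x \<in> carrier B \<Longrightarrow> cscale B 1 x = x"
    and mult_cscale_left: "\<lbrakk>x \<in> carrier B; y \<in> carrier B\<rbrakk> \<Longrightarrow>
          cscale B c x \<otimes> y = cscale B c (x \<otimes> y)"
    and mult_cscale_right: "\<lbrakk>x \<in> carrier B; y \<in> carrier B\<rbrakk> \<Longrightarrow>
          x \<otimes> cscale B c y = cscale B c (x \<otimes> y)"
    and cadj_add: "\<lbrakk>x \<in> carrier B; y \<in> carrier B\<rbrakk> \<Longrightarrow> cadj B (x \<oplus> y) = cadj B x \<oplus> cadj B y"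
    and cadj_cscale: "x \<in> carrier B \<Longrightarrow> cadj B (cscale B c x) = cscale B (cnj c) (cadj B x)"
    and cadj_mult: "\<lbrakk>x \<in> carrier B; y \<in> carrier B\<rbrakk> \<Longrightarrow> cadj B (x \<otimes> y) = cadj B y \<otimes> cadj B x"
    and cadj_cadj: "x \<in> carrier B \<Longrightarrow> cadj B (cadj B x) = x"
    and cnorm_nonneg: "x \<in> carrier B \<Longrightarrow> 0 \<le> cnorm B x"
    and cnorm_eq_zero: "x \<in> carrier B \<Longrightarrow> cnorm B x = 0 \<longleftrightarrow> x = \<zero>"
    and cnorm_triangle: "\<lbrakk>x \<in> carrier B; y \<in> carrier B\<rbrakk> \<Longrightarrow>
          cnorm B (x \<oplus> y) \<le> cnorm B x + cnorm B y"
    and cnorm_cscale: "x \<in> carrier B \<Longrightarrow> cnorm B (cscale B c x) = cmod c * cnorm B x"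
    and cnorm_mult: "\<lbrakk>x \<in> carrier B; y \<in> carrier B\<rbrakk> \<Longrightarrow>
          cnorm B (x \<otimes> y) \<le> cnorm B x * cnorm B y"
    and cnorm_cstar: "x \<in> carrier B \<Longrightarrow> cnorm B (cadj B x \<otimes> x) = (cnorm B x)\<^sup>2"
    and complete: "\<lbrakk>range \<sigma> \<subseteq> carrier B;
          \<forall>e>0. \<exists>N. \<forall>m\<ge>N. \<forall>n\<ge>N. cnorm B (\<sigma> m \<ominus> \<sigma> n) < e\<rbrakk> \<Longrightarrow>
          \<exists>x\<in>carrier B. (\<lambda>n. cnorm B (\<sigma> n \<ominus> x)) \<longlonglongrightarrow> 0"

definition whole :: "'a::cstar_algebra cstar" where
  "whole = \<lparr>carrier = UNIV, mult = (*), one = 1, zero = 0, add = (+),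
     cscale = scaleC, cadj = adj, cnorm = norm\<rparr>"

lemma cstar_algebra_on_whole: "cstar_algebra_on (whole :: 'a::cstar_algebra cstar)"
proof -
  have R: "ring (whole :: 'a cstar)"
    by (rule ringI; unfold_locales)
       (auto simp: whole_def Units_def algebra_simps intro: exI[of _ "- x" for x])
  interpret ring "whole :: 'a cstar" by (rule R)
  have neg: "\<ominus>\<^bsub>whole\<^esub> x = - x" for x :: 'a
    by (rule minus_equality) (auto simp: whole_def)
  have sub: "x \<ominus>\<^bsub>whole\<^esub> y = x - y" for x y :: 'a
    unfolding a_minus_def neg by (simp add: whole_def)
  have compl: "\<exists>x. (\<lambda>n. norm (f n - x)) \<longlonglongrightarrow> 0"
    if "\<forall>e>0. \<exists>N. \<forall>m\<ge>N. \<forall>n\<ge>N. norm (f m - f n) < e" for f :: "nat \<Rightarrow> 'a"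
  proof -
    have "Cauchy f" using that by (simp add: Cauchy_def dist_norm)
    then obtain x where "f \<longlonglongrightarrow> x" using Cauchy_convergent convergentD by blast
    then show ?thesis using LIM_zero tendsto_norm_zero by blast
  qed
  have one: "1 *\<^sub>C x = x" for x :: 'a using scaleR_scaleC[of 1 x] by simp
  show ?thesis
    by unfold_locales
       (unfold sub, auto simp: whole_def scaleC_add_right scaleC_add_left scaleC_scaleC one
          mult_scaleC_left mult_scaleC_right norm_scaleC adj_add adj_scaleC adj_mult adj_adj
          cstar_identity norm_triangle_ineq norm_mult_ineq compl)
qed

definition unital_star_hom :: "('a::cstar_algebra \<Rightarrow> 'b) \<Rightarrow> 'b cstar \<Rightarrow> bool" where
  "unital_star_hom h B \<longleftrightarrow> h \<in> ring_hom whole B \<and>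
     (\<forall>c x. h (c *\<^sub>C x) = cscale B c (h x)) \<and> (\<forall>x. h (adj x) = cadj B (h x))"

text \<open>Subsets \<open>A\<close> of the ambient algebra; closedness is norm closedness.\<close>

definition unital_cstar_subalgebra :: "'a::cstar_algebra set \<Rightarrow> bool" where
  "unital_cstar_subalgebra A \<longleftrightarrow> closed A \<and> cspace.subspace A \<and> 1 \<in> A \<and>
     (\<forall>x\<in>A. \<forall>y\<in>A. x * y \<in> A) \<and> (\<forall>x\<in>A. adj x \<in> A)"

definition closed_ideal :: "'a::cstar_algebra set \<Rightarrow> 'a set \<Rightarrow> bool" where
  "closed_ideal A J \<longleftrightarrow> J \<subseteq> A \<and> closed J \<and> cspace.subspace J \<and>
     (\<forall>a\<in>A. \<forall>x\<in>J. a * x \<in> J \<and> x * a \<in> J)"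

definition simple_cstar :: "'a::cstar_algebra set \<Rightarrow> bool" where
  "simple_cstar A \<longleftrightarrow> A \<noteq> {0} \<and> (\<forall>J. closed_ideal A J \<longrightarrow> J = {0} \<or> J = A)"

definition unitaries :: "'a::cstar_algebra set \<Rightarrow> 'a set" where
  "unitaries A = {u \<in> A. adj u * u = 1 \<and> u * adj u = 1}"

definition centre :: "'a::cstar_algebra set \<Rightarrow> 'a set" where
  "centre A = {z \<in> A. \<forall>a\<in>A. z * a = a * z}"

definition Ave :: "'a::cstar_algebra set \<Rightarrow> ('a \<Rightarrow> 'a) set" where
  "Ave U = {\<alpha>. \<exists>(n::nat) (l :: nat \<Rightarrow> real) (u :: nat \<Rightarrow> 'a).
     n \<ge> 1 \<and> (\<forall>i\<in>{1..n}. u i \<in> U \<and> l i > 0) \<and> (\<Sum>i=1..n. l i) = 1 \<and>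
     \<alpha> = (\<lambda>a. \<Sum>i=1..n. l i *\<^sub>R (u i * a * adj (u i)))}"

definition dixmier_property :: "'a::cstar_algebra set \<Rightarrow> bool" where
  "dixmier_property A \<longleftrightarrow>
     (\<forall>a\<in>A. closure {\<alpha> a | \<alpha>. \<alpha> \<in> Ave (unitaries A)} \<inter> centre A \<noteq> {})"


section \<open>Single vertex k-graphs\<close>

text \<open>\<open>\<Lambda>\<close> is the whole type \<open>'l\<close>, and \<open>\<nat>\<^sup>k\<close> is \<open>nat ^ 'k\<close>; the linear order on the index type \<open>'k\<close>
  serves to express \<open>i < j\<close>.\<close>

definition edges :: "('l \<Rightarrow> nat ^ 'k) \<Rightarrow> 'k \<Rightarrow> 'l set" where
  "edges d i = {e. d e = axis i 1}"

locale single_vertex_kgraph =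
  fixes d :: "'l::monoid_mult \<Rightarrow> nat ^ 'k::{finite,linorder}"
  assumes degree_one: "d 1 = 0"
    and degree_mult: "d (x * y) = d x + d y"
    and factorization: "d l = p + q \<Longrightarrow> \<exists>!(m, n). l = m * n \<and> d m = p \<and> d n = q"
    and finite_edges: "finite (edges d i)"

definition degree_sup :: "nat ^ 'k \<Rightarrow> nat ^ 'k \<Rightarrow> nat ^ 'k" where
  "degree_sup p q = (\<chi> i. max (p $ i) (q $ i))"

definition Lambda_min :: "('l::monoid_mult \<Rightarrow> nat ^ 'k) \<Rightarrow> 'l \<Rightarrow> 'l \<Rightarrow> ('l \<times> 'l) set" where
  "Lambda_min d m n = {(x, y). m * x = n * y \<and> d (m * x) = degree_sup (d m) (d n)}"

text \<open>Finiteness is stated because \<open>card\<close> of an infinite set is 0.\<close>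

definition little_pullback :: "('l::monoid_mult \<Rightarrow> nat ^ 'k) \<Rightarrow> bool" where
  "little_pullback d \<longleftrightarrow> (\<forall>i j. i \<noteq> j \<longrightarrow> (\<forall>e\<in>edges d i. \<forall>f\<in>edges d j.
     finite (Lambda_min d e f) \<and> card (Lambda_min d e f) \<le> 1))"


section \<open>The C*-algebra of a single vertex k-graph\<close>

text \<open>A tuple is indexed by the finite set \<open>F\<close> of edges themselves rather than by \<open>1..m\<close>.\<close>

definition cuntz_type :: "'b cstar \<Rightarrow> 'l set \<Rightarrow> ('l \<Rightarrow> 'b) \<Rightarrow> bool" where
  "cuntz_type B F V \<longleftrightarrow> V ` F \<subseteq> carrier B \<and>
     (\<forall>e\<in>F. \<forall>f\<in>F. cadj B (V e) \<otimes>\<^bsub>B\<^esub> V f = (if e = f then \<one>\<^bsub>B\<^esub> else \<zero>\<^bsub>B\<^esub>)) \<and>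
     (\<Oplus>\<^bsub>B\<^esub>e\<in>F. V e \<otimes>\<^bsub>B\<^esub> cadj B (V e)) = \<one>\<^bsub>B\<^esub>"

text \<open>\<open>e * f = f' * e'\<close> in \<open>\<Lambda>\<close> says that the permutation \<open>\<theta>\<^sub>i\<^sub>j\<close> maps \<open>(e, f)\<close> to \<open>(e', f')\<close>.
  Only the values of \<open>E\<close> on edges matter.\<close>

definition cuntz_representation ::
    "('l::monoid_mult \<Rightarrow> nat ^ 'k::{finite,linorder}) \<Rightarrow> 'b cstar \<Rightarrow> ('l \<Rightarrow> 'b) \<Rightarrow> bool" where
  "cuntz_representation d B E \<longleftrightarrow> (\<forall>i. cuntz_type B (edges d i) E) \<and>
     (\<forall>i j. i < j \<longrightarrow> (\<forall>e\<in>edges d i. \<forall>f\<in>edges d j. \<forall>e'\<in>edges d i. \<forall>f'\<in>edges d j.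
        e * f = f' * e' \<longrightarrow> E e \<otimes>\<^bsub>B\<^esub> E f = E f' \<otimes>\<^bsub>B\<^esub> E e'))"

text \<open>The type \<open>'a\<close>, with generators \<open>s\<close>, is \<open>\<O>\<^sub>\<theta>\<close>. It is enough that the C*-algebras \<open>B\<close> range over
  those whose carrier is a set of elements of \<open>'a\<close>: the C*-subalgebra generated by a Cuntz-type
  representation in any C*-algebra is separable, so it has at most continuum many elements,
  while \<open>'a\<close>, a nonzero complex vector space, has at least that many; hence it has an isomorphic
  copy among these \<open>B\<close>.

  Aperiodicity of the k-graph is by definition simplicity of \<open>\<O>\<^sub>\<theta>\<close>, that is, of \<open>UNIV :: 'a set\<close>.\<close>

definition is_O_theta ::
    "('l::monoid_mult \<Rightarrow> nat ^ 'k::{finite,linorder}) \<Rightarrow> ('l \<Rightarrow> 'a::cstar_algebra) \<Rightarrow> bool" where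
  "is_O_theta d s \<longleftrightarrow> cuntz_representation d whole s \<and>
     (\<forall>A. unital_cstar_subalgebra A \<and> (\<forall>i. s ` edges d i \<subseteq> A) \<longrightarrow> A = UNIV) \<and>
     (\<forall>(B :: 'a cstar) E. cstar_algebra_on B \<and> cuntz_representation d B E \<longrightarrow>
        (\<exists>h. unital_star_hom h B \<and> (\<forall>i. \<forall>e\<in>edges d i. h (s e) = E e)))"

definition gen_word :: "('l \<Rightarrow> 'a::cstar_algebra) \<Rightarrow> 'l list \<Rightarrow> 'a" where
  "gen_word s w = prod_list (map s w)"

text \<open>An element of \<open>\<Lambda>\<close> is represented by the words \<open>w\<close> in the edges whose product it is;
  \<open>d (prod_list w)\<close> is its degree.\<close>

definition X0 :: "('l::monoid_mult \<Rightarrow> nat ^ 'k) \<Rightarrow> ('l \<Rightarrow> 'a::cstar_algebra) \<Rightarrow> 'a set" where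
  "X0 d s = cspace.span {gen_word s u * adj (gen_word s v) | u v.
     set u \<subseteq> (\<Union>i. edges d i) \<and> set v \<subseteq> (\<Union>i. edges d i) \<and> d (prod_list u) = d (prod_list v)}"

end

theory Submission
  imports Defs
begin

text \<open>
  Write \<open>S l\<close> for the isometry \<open>s\<^sub>l\<close> of an element \<open>l\<close> of the monoid, and for a degree \<open>p\<close> let \<open>n\<^sub>p\<close> be the number of elements of
  degree \<open>p\<close>. The products \<open>S l * adj (S m)\<close> with \<open>d l = d m = p\<close> are matrix units of a full matrix algebra of
  size \<open>n\<^sub>p\<close>, contained in \<open>X0\<close> and so in \<open>A\<close>. Averaging \<open>x\<close> over the finitely many Weyl unitaries of this matrix algebra
  gives the block-diagonal element \<open>\<Sum>l. S l * L\<^sub>p(x) * adj (S l)\<close>, where \<open>L\<^sub>p(x)\<close> is the mean of the compressions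
  \<open>adj (S l) * x * S l\<close> (\<open>matrix_unit_average_in_Ave\<close>). Block-diagonal embedding is contractive, so these averages converge to a
  scalar as soon as the compressions \<open>L\<^sub>p(x)\<close> do.

  They do, for every \<open>x\<close> in the ambient algebra. By density it is enough to treat \<open>x = S u * adj (S v)\<close>. If
  \<open>d u = d v\<close>, compression by this degree already gives a scalar. If the degrees differ in coordinate \<open>i\<close>, that is, in the
  number of edges of colour \<open>i\<close>, the little
  pull-back property ensures that \<open>adj (S e) * S v\<close>, for an edge \<open>e\<close> of a colour absent from \<open>v\<close>, is zero or a
  single monomial. Hence compressing once in colour \<open>i\<close> gives zero or a monomial of the same kind divided by
  the number of edges of colour \<open>i\<close> (\<open>compress_monomial\<close>). This number is at least 2: a colour with one edge
  would yield a central unitary that is moved by a gauge homomorphism, which is impossible in a simple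
  algebra (\<open>O_theta_simple_two_edges\<close>). So the compressions tend to 0.

  The limits define a functional \<open>state\<close>, and \<open>state x\<close> is a norm limit of averages of \<open>x\<close> over unitaries of \<open>A\<close>; this is the Dixmier
  property. For simplicity of \<open>A\<close>, a nonzero closed ideal contains some \<open>adj x * x\<close> with \<open>x\<close> nonzero, hence the averages
  of this element, hence the scalar \<open>state (adj x * x)\<close>, and it remains to see that this scalar is not zero
  (\<open>state_faithful\<close>). The state is positive, because \<open>L\<^sub>p(adj x * x)\<close> is again of the form \<open>adj y * y\<close> and limits of
  such squares are not negative scalars, and it satisfies the KMS condition \<open>state (S l * y) = state (y * S l) / n\<^sub>p\<close> with
  \<open>p = d l\<close>. By Cauchy-Schwarz and this condition, an \<open>x\<close> with \<open>state (adj x * x) = 0\<close> satisfies \<open>state (y * x * z) = 0\<close>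
  for all \<open>y\<close>, \<open>z\<close>. Such elements form a proper closed ideal of the ambient simple algebra, so \<open>x = 0\<close>.
\<close>

section \<open>Elementary C*-algebra\<close>

lemma adj_zero [simp]: "adj (0 :: 'a::cstar_algebra) = 0"
  using adj_add[of "0::'a" 0] by simp

lemma adj_one [simp]: "adj (1 :: 'a::cstar_algebra) = 1"
  using adj_mult[of "adj (1::'a)" 1] by (simp add: adj_adj)

lemma adj_minus: "adj (- x) = - adj (x :: 'a::cstar_algebra)"
  using adj_add[of x "- x"] by (simp add: eq_neg_iff_add_eq_0 add.commute)

lemma adj_diff: "adj (x - y) = adj x - adj (y :: 'a::cstar_algebra)"
  using adj_add[of x "- y"] by (simp add: adj_minus)

lemma adj_sum: "adj (\<Sum>i\<in>F. f i) = (\<Sum>i\<in>F. adj (f i :: 'a::cstar_algebra))"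
  by (induction F rule: infinite_finite_induct) (auto simp: adj_add)

lemma adj_power: "adj (x ^ n) = adj (x :: 'a::cstar_algebra) ^ n"
  by (induction n) (auto simp: adj_mult power_commutes)

lemma adj_scaleR: "adj (r *\<^sub>R x) = r *\<^sub>R adj (x :: 'a::cstar_algebra)"
  by (simp add: scaleR_scaleC adj_scaleC)

lemma norm_adj [simp]: "norm (adj x) = norm (x :: 'a::cstar_algebra)"
proof -
  have le: "norm y \<le> norm (adj y)" for y :: 'a
  proof (cases "y = 0")
    case False
    have "norm y * norm y \<le> norm (adj y) * norm y"
      using cstar_identity[of y] norm_mult_ineq[of "adj y" y] by (simp add: power2_eq_square)
    with False show ?thesis by simp
  qed simp
  show ?thesis using le[of x] le[of "adj x"] by (simp add: adj_adj)
qed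

lemma bounded_linear_adj: "bounded_linear (adj :: 'a::cstar_algebra \<Rightarrow> 'a)"
  by (rule bounded_linear_intro[where K = 1]) (auto simp: adj_add adj_scaleR)

lemma bounded_linear_scaleC: "bounded_linear (\<lambda>x :: 'a::cstar_algebra. c *\<^sub>C x)"
  by (rule bounded_linear_intro[where K = "cmod c"])
     (auto simp: scaleC_add_right norm_scaleC scaleR_scaleC scaleC_scaleC mult.commute)

lemma bounded_linear_scaleC_left: "bounded_linear (\<lambda>c. c *\<^sub>C (x :: 'a::cstar_algebra))"
  by (rule bounded_linear_intro[where K = "norm x"])
     (auto simp: scaleC_add_left norm_scaleC scaleR_scaleC scaleC_scaleC scaleR_conv_of_real)

lemmas tendsto_adj [tendsto_intros] = bounded_linear.tendsto[OF bounded_linear_adj]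
lemmas tendsto_scaleC_right [tendsto_intros] = bounded_linear.tendsto[OF bounded_linear_scaleC]
lemmas tendsto_scaleC_left [tendsto_intros] = bounded_linear.tendsto[OF bounded_linear_scaleC_left]

lemma scalar_mult: "(c *\<^sub>C 1) * x = c *\<^sub>C (x :: 'a::cstar_algebra)"
  by (simp add: mult_scaleC_left)

lemma mult_scalar: "x * (c *\<^sub>C 1) = c *\<^sub>C (x :: 'a::cstar_algebra)"
  by (simp add: mult_scaleC_right)

lemma scalar_eq_iff: "c *\<^sub>C (1 :: 'a::cstar_algebra) = c' *\<^sub>C 1 \<longleftrightarrow> c = c'"
  by simp

lemma norm_isometry: "adj x * x = 1 \<Longrightarrow> norm (x :: 'a::cstar_algebra) = 1"
  using cstar_identity[of x] norm_ge_zero[of x] by (auto simp: power2_eq_1_iff)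

lemma isometry_power:
  "adj x * x = 1 \<Longrightarrow> adj (x ^ n) * x ^ n = (1 :: 'a::cstar_algebra)"
proof (induction n)
  case (Suc n)
  have "adj (x ^ Suc n) * x ^ Suc n = adj (x ^ n) * (adj x * x) * x ^ n"
    by (simp add: adj_mult mult.assoc)
  with Suc show ?case by simp
qed simp


section \<open>Limits of squares are positive\<close>

text \<open>Functional calculus is replaced by a single polynomial identity. For \<open>h = t a\<close> with \<open>t\<^sup>2 = 2 \<delta>\<close>, the
  quadratic Taylor polynomial \<open>p = 1 + \<i> h - h\<^sup>2 / 2\<close> of \<open>exp (\<i> h)\<close> is almost unitary, since
  \<open>adj p * p = 1 + h\<^sup>4 / 4\<close>, and its real part is \<open>1 - \<delta> a\<^sup>2\<close>. The point is that the excess over 1 is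
  of second order in \<open>\<delta>\<close>: to first order, the square of a self-adjoint element is positive.\<close>

lemma norm_one_minus_square_le:
  fixes a :: "'a::cstar_algebra"
  assumes sa: "adj a = a" and "0 \<le> \<delta>"
  shows "norm (1 - \<delta> *\<^sub>R (a * a)) \<le> 1 + \<delta>\<^sup>2 * norm a ^ 4 / 2"
proof -
  define t where "t = sqrt (2 * \<delta>)"
  have t2: "t * t = 2 * \<delta>" using \<open>0 \<le> \<delta>\<close> by (simp add: t_def)
  define q :: 'a where "q = 1 - \<delta> *\<^sub>R (a * a)"
  define h where "h = t *\<^sub>R a"
  define p where "p = q + \<i> *\<^sub>C h"
  have hh: "h * h = (2 * \<delta>) *\<^sub>R (a * a)" by (simp add: h_def t2)
  have comm: "h * q = q * h" by (simp add: h_def q_def algebra_simps)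
  have adjq: "adj q = q" by (simp add: q_def adj_diff adj_scaleR adj_mult sa)
  have adjh: "adj h = h" by (simp add: h_def adj_scaleR sa)
  have adjp: "adj p = q - \<i> *\<^sub>C h"
    by (simp add: p_def adj_add adj_scaleC adjq adjh)
  have "adj p * p = q * q + h * h"
    unfolding adjp unfolding p_def
    by (simp add: algebra_simps mult_scaleC_left mult_scaleC_right scaleC_scaleC comm)
  also have "\<dots> = 1 + \<delta>\<^sup>2 *\<^sub>R (a * a * (a * a))"
    unfolding hh q_def
    by (simp add: algebra_simps power2_eq_square flip: scaleR_2)
  finally have pp: "adj p * p = 1 + \<delta>\<^sup>2 *\<^sub>R (a * a * (a * a))" .
  have "norm (a * a * (a * a)) \<le> norm a ^ 4"
    using norm_mult_ineq[of "a * a" "a * a"] norm_mult_ineq[of a a]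
      mult_mono[OF norm_mult_ineq[of a a] norm_mult_ineq[of a a]]
    by (simp add: power4_eq_xxxx mult.assoc)
  then have "norm (\<delta>\<^sup>2 *\<^sub>R (a * a * (a * a))) \<le> \<delta>\<^sup>2 * norm a ^ 4"
    by (simp add: mult_left_mono)
  then have "(norm p)\<^sup>2 \<le> 1 + \<delta>\<^sup>2 * norm a ^ 4"
    unfolding cstar_identity[of p, symmetric] pp
    using norm_triangle_ineq[of 1 "\<delta>\<^sup>2 *\<^sub>R (a * a * (a * a))"] by simp
  also have "\<dots> \<le> (1 + \<delta>\<^sup>2 * norm a ^ 4 / 2)\<^sup>2"
    using zero_le_power2[of "\<delta>\<^sup>2 * norm a ^ 4 / 2"] by (simp add: power2_sum)
  finally have np: "norm p \<le> 1 + \<delta>\<^sup>2 * norm a ^ 4 / 2"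
    by (rule power2_le_imp_le) simp
  have "q = (1/2) *\<^sub>R (p + adj p)"
    unfolding adjp unfolding p_def by (simp flip: scaleR_2)
  then have "norm q \<le> (1/2) * (norm p + norm (adj p))"
    by (metis norm_scaleR norm_triangle_ineq abs_of_nonneg mult_left_mono zero_le_divide_1_iff
        zero_le_numeral)
  with np show ?thesis by (simp add: q_def)
qed

text \<open>Apply the previous bound to the real and imaginary parts \<open>a\<close>, \<open>b\<close> of \<open>y\<close>:
  \<open>adj y * y + y * adj y = 2 (a\<^sup>2 + b\<^sup>2)\<close>, and the norm is convex.\<close>

lemma norm_one_minus_squares_le:
  fixes y :: "'a::cstar_algebra"
  assumes "0 \<le> \<eta>"
  shows "norm (1 - \<eta> *\<^sub>R (adj y * y + y * adj y)) \<le> 1 + 8 * \<eta>\<^sup>2 * norm y ^ 4"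
proof -
  define a where "a = (1/2) *\<^sub>R (y + adj y)"
  define b where "b = (1/2) *\<^sub>R (\<i> *\<^sub>C (adj y - y))"
  have sa: "adj a = a" "adj b = b"
    by (simp_all add: a_def b_def adj_scaleR adj_add adj_adj adj_diff adj_scaleC algebra_simps)
  have na: "norm a \<le> norm y" using norm_triangle_ineq[of y "adj y"] by (simp add: a_def)
  have nb: "norm b \<le> norm y" using norm_triangle_ineq4[of "adj y" y] by (simp add: b_def norm_scaleC)
  have ab: "adj y * y + y * adj y = 2 *\<^sub>R (a * a) + 2 *\<^sub>R (b * b)"
  proof -
    have "a * a = (1/4) *\<^sub>R ((y + adj y) * (y + adj y))" by (simp add: a_def)
    moreover have "b * b = - ((1/4) *\<^sub>R ((adj y - y) * (adj y - y)))"
      by (simp add: b_def mult_scaleC_left mult_scaleC_right scaleC_scaleC scaleR_scaleC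
          flip: cspace.scale_minus_left)
    ultimately have "4 *\<^sub>R (a * a + b * b) = (y + adj y) * (y + adj y) - (adj y - y) * (adj y - y)"
      by (simp add: scaleR_right_diff_distrib)
    also have "\<dots> = 2 *\<^sub>R (adj y * y + y * adj y)" by (simp add: algebra_simps scaleR_2)
    finally have "(1/2) *\<^sub>R (4 *\<^sub>R (a * a + b * b)) = (1/2) *\<^sub>R (2 *\<^sub>R (adj y * y + y * adj y))" by simp
    then show ?thesis by (simp add: scaleR_add_right)
  qed
  have bound: "norm (1 - (4 * \<eta>) *\<^sub>R (c * c)) \<le> 1 + 8 * \<eta>\<^sup>2 * norm y ^ 4"
    if "adj c = c" "norm c \<le> norm y" for c
  proof -
    have "(4 * \<eta>)\<^sup>2 * norm c ^ 4 / 2 \<le> (4 * \<eta>)\<^sup>2 * norm y ^ 4 / 2"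
      using that(2) by (intro divide_right_mono mult_left_mono power_mono) auto
    with norm_one_minus_square_le[OF that(1), of "4 * \<eta>"] assms show ?thesis
      by (simp add: power_mult_distrib)
  qed
  have "1 - \<eta> *\<^sub>R (adj y * y + y * adj y) =
      (1/2) *\<^sub>R ((1 - (4 * \<eta>) *\<^sub>R (a * a)) + (1 - (4 * \<eta>) *\<^sub>R (b * b)))"
    unfolding ab by (simp add: algebra_simps flip: scaleR_2)
  also have "norm \<dots> \<le> (1/2) * (norm (1 - (4 * \<eta>) *\<^sub>R (a * a)) + norm (1 - (4 * \<eta>) *\<^sub>R (b * b)))"
    using norm_triangle_ineq[of "1 - (4 * \<eta>) *\<^sub>R (a * a)" "1 - (4 * \<eta>) *\<^sub>R (b * b)"] by simp
  also have "\<dots> \<le> 1 + 8 * \<eta>\<^sup>2 * norm y ^ 4" using bound[OF sa(1) na] bound[OF sa(2) nb] by simp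
  finally show ?thesis .
qed

text \<open>If \<open>adj y * y\<close> were close to \<open>- r\<close> with \<open>r > 0\<close>, then compressing
  \<open>1 - \<eta> (adj y * y + y * adj y)\<close> by \<open>y\<close> would give an element close to \<open>- r - 2 \<eta> r\<^sup>2\<close>, because
  \<open>adj y * (y * adj y) * y\<close> is \<open>(adj y * y)\<^sup>2\<close>, close to \<open>r\<^sup>2\<close>. By the previous lemma its norm is at most
  about \<open>r (1 + 8 \<eta>\<^sup>2 r\<^sup>2)\<close>, and the two are incompatible for small \<open>\<eta>\<close>. This is the classical argument
  that \<open>adj y * y\<close> cannot be negative, carried out for scalars only.\<close>

lemma scalar_limit_of_squares_nonneg:
  fixes y :: "nat \<Rightarrow> 'a::cstar_algebra"
  assumes lim: "(\<lambda>n. adj (y n) * y n) \<longlonglongrightarrow> c *\<^sub>C 1"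
  shows "Im c = 0 \<and> 0 \<le> Re c"
proof -
  have "(\<lambda>n. adj (adj (y n) * y n)) \<longlonglongrightarrow> adj (c *\<^sub>C 1)" by (intro tendsto_intros lim)
  then have "(\<lambda>n. adj (y n) * y n) \<longlonglongrightarrow> cnj c *\<^sub>C 1"
    by (simp add: adj_mult adj_adj adj_scaleC)
  with lim have "c *\<^sub>C (1::'a) = cnj c *\<^sub>C 1" by (rule LIMSEQ_unique)
  then have "c = cnj c" by (simp only: scalar_eq_iff)
  then have im: "Im c = 0" by (metis complex_cnj cnj.simps(2) eq_neg_iff_add_eq_0 add_self_div_2 div_0 equal_neg_zero)
  have False if neg: "Re c < 0"
  proof -
    define r where "r = - Re c"
    have r: "r > 0" using neg by (simp add: r_def)
    have c: "c *\<^sub>C (1::'a) = - (r *\<^sub>R 1)"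
      using im by (simp add: scaleR_scaleC r_def complex_eq_iff flip: cspace.scale_minus_left)
    let ?g = "\<lambda>n. adj (y n) * y n"
    \<comment> \<open>Any positive \<open>\<eta> < 1 / (4 * r)\<close> leads to the contradiction.\<close>
    define \<eta> where "\<eta> = 1 / (8 * r)"
    have g: "?g \<longlonglongrightarrow> - (r *\<^sub>R 1)" using lim by (simp add: c)
    have "(\<lambda>n. norm (?g n)) \<longlonglongrightarrow> norm (- (r *\<^sub>R (1::'a)))" by (intro tendsto_norm g)
    then have ny2: "(\<lambda>n. (norm (y n))\<^sup>2) \<longlonglongrightarrow> r" using r by (simp add: cstar_identity)
    define e where "e = (\<lambda>n. ?g n + r *\<^sub>R 1)"
    have e: "e \<longlonglongrightarrow> 0" using tendsto_add[OF g tendsto_const[of "r *\<^sub>R 1"]] by (simp add: e_def)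
    have yey: "(\<lambda>n. adj (y n) * e n * y n) \<longlonglongrightarrow> 0"
    proof (rule tendsto_norm_zero_cancel, rule Lim_null_comparison)
      show "\<forall>\<^sub>F n in sequentially. norm (norm (adj (y n) * e n * y n)) \<le> (norm (y n))\<^sup>2 * norm (e n)"
      proof (intro always_eventually allI)
        fix n
        have "norm (adj (y n) * e n * y n) \<le> norm (adj (y n) * e n) * norm (y n)"
          by (rule norm_mult_ineq)
        also have "\<dots> \<le> (norm (adj (y n)) * norm (e n)) * norm (y n)"
          by (intro mult_right_mono norm_mult_ineq) simp
        finally show "norm (norm (adj (y n) * e n * y n)) \<le> (norm (y n))\<^sup>2 * norm (e n)"
          by (simp add: power2_eq_square mult_ac)
      qed
      show "(\<lambda>n. (norm (y n))\<^sup>2 * norm (e n)) \<longlonglongrightarrow> 0"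
        using tendsto_mult[OF ny2 tendsto_norm[OF e]] by simp
    qed
    let ?k = "\<lambda>n. adj (y n) * (1 - \<eta> *\<^sub>R (adj (y n) * y n + y n * adj (y n))) * y n"
    have k_eq: "?k n = ?g n - \<eta> *\<^sub>R (adj (y n) * e n * y n - r *\<^sub>R ?g n + ?g n * ?g n)" for n
      by (simp add: e_def algebra_simps)
    have "?k \<longlonglongrightarrow> - (r *\<^sub>R 1) - \<eta> *\<^sub>R (0 - r *\<^sub>R (- (r *\<^sub>R 1)) + (- (r *\<^sub>R 1)) * (- (r *\<^sub>R 1)))"
      unfolding k_eq by (intro tendsto_intros g yey)
    also have "- (r *\<^sub>R 1) - \<eta> *\<^sub>R (0 - r *\<^sub>R (- (r *\<^sub>R 1)) + (- (r *\<^sub>R 1)) * (- (r *\<^sub>R 1)))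
        = - (r + 2 * \<eta> * r\<^sup>2) *\<^sub>R (1::'a)"
      by (simp add: algebra_simps power2_eq_square flip: scaleR_2)
    finally have k: "?k \<longlonglongrightarrow> - (r + 2 * \<eta> * r\<^sup>2) *\<^sub>R 1" .
    have kn: "(\<lambda>n. norm (?k n)) \<longlonglongrightarrow> r + 2 * \<eta> * r\<^sup>2"
    proof -
      have "0 \<le> r + 2 * \<eta> * r\<^sup>2" using r by (simp add: \<eta>_def)
      with tendsto_norm[OF k] show ?thesis
        by (simp only: norm_scaleR norm_one abs_minus_cancel abs_of_nonneg mult_1_right)
    qed
    have bound: "norm (?k n) \<le> (norm (y n))\<^sup>2 * (1 + 8 * \<eta>\<^sup>2 * ((norm (y n))\<^sup>2)\<^sup>2)" for n
    proof -
      let ?m = "1 - \<eta> *\<^sub>R (adj (y n) * y n + y n * adj (y n))"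
      have "norm (?k n) \<le> norm (adj (y n) * ?m) * norm (y n)" by (rule norm_mult_ineq)
      also have "\<dots> \<le> (norm (adj (y n)) * norm ?m) * norm (y n)"
        by (intro mult_right_mono norm_mult_ineq) simp
      also have "\<dots> = (norm (y n))\<^sup>2 * norm ?m" by (simp add: power2_eq_square mult_ac)
      also have "\<dots> \<le> (norm (y n))\<^sup>2 * (1 + 8 * \<eta>\<^sup>2 * norm (y n) ^ 4)"
        using r by (intro mult_left_mono norm_one_minus_squares_le) (auto simp: \<eta>_def)
      finally show ?thesis by simp
    qed
    have "(\<lambda>n. (norm (y n))\<^sup>2 * (1 + 8 * \<eta>\<^sup>2 * ((norm (y n))\<^sup>2)\<^sup>2)) \<longlonglongrightarrow> r * (1 + 8 * \<eta>\<^sup>2 * r\<^sup>2)"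
      by (intro tendsto_intros ny2)
    with kn have "r + 2 * \<eta> * r\<^sup>2 \<le> r * (1 + 8 * \<eta>\<^sup>2 * r\<^sup>2)"
      by (rule LIMSEQ_le) (use bound in blast)
    then show False using r by (simp add: \<eta>_def power2_eq_square field_simps)
  qed
  with im show ?thesis by force
qed


section \<open>Sums over roots of unity\<close>

definition unity_root :: "nat \<Rightarrow> nat \<Rightarrow> complex" where
  "unity_root n j = cis (2 * pi * real j / real n)"

lemma norm_unity_root [simp]: "cmod (unity_root n j) = 1"
  by (simp add: unity_root_def)

lemma cnj_unity_root: "unity_root n j * cnj (unity_root n j) = 1"
  by (metis norm_unity_root complex_norm_square of_real_1 power_one)

lemma unity_root_power_n: "n > 0 \<Longrightarrow> unity_root n j ^ n = 1"
  by (simp add: unity_root_def Complex.DeMoivre cis_multiple_2pi)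

lemma unity_root_power: "unity_root n j ^ k = unity_root n k ^ j"
  by (simp add: unity_root_def Complex.DeMoivre mult_ac)

lemma unity_root_orthogonal:
  assumes "a < n" "b < n"
  shows "(\<Sum>j<n. unity_root n j ^ a * cnj (unity_root n j ^ b)) = (if a = b then of_nat n else 0)"
proof (cases "a = b")
  case True
  have "unity_root n j ^ a * cnj (unity_root n j ^ a) = 1" for j
    by (simp add: cnj_unity_root flip: power_mult_distrib)
  with True show ?thesis by simp
next
  case False
  let ?w = "unity_root n a * cnj (unity_root n b)"
  have eq: "unity_root n j ^ a * cnj (unity_root n j ^ b) = ?w ^ j" for j
    by (simp add: unity_root_power[of n j] power_mult_distrib)
  have "?w ^ n = 1"
    using assms by (simp add: power_mult_distrib unity_root_power_n flip: complex_cnj_power)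
  moreover have "?w \<noteq> 1"
  proof
    assume "?w = 1"
    then have "cis (2 * pi * (real a - real b) / real n) = 1"
      by (simp add: unity_root_def cis_cnj cis_mult diff_divide_distrib algebra_simps)
    then have "cos (2 * pi * (real a - real b) / real n) = 1" by (simp add: complex_eq_iff)
    then obtain m :: int where "2 * pi * (real a - real b) / real n = of_int m * 2 * pi"
      using cos_one_2pi_int by blast
    then have "2 * pi * ((real a - real b) / real n) = 2 * pi * of_int m" by simp
    then have "(real a - real b) / real n = of_int m"
      by (metis mult_cancel_left pi_neq_zero mult_eq_0_iff zero_neq_numeral times_divide_eq_right)
    then have "real a - real b = of_int m * real n" using assms by (simp add: field_simps)
    then have "of_int (int a - int b) = (of_int (m * int n) :: real)" by simp
    then have m: "int a - int b = m * int n" by (simp only: of_int_eq_iff)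
    with False have "m \<noteq> 0" by auto
    then have "\<bar>int a - int b\<bar> \<ge> int n"
      using mult_right_mono[of 1 "\<bar>m\<bar>" "int n"] unfolding m by (simp add: abs_mult)
    with assms show False by linarith
  qed
  ultimately have "(\<Sum>j<n. ?w ^ j) = 0" by (simp add: geometric_sum)
  with False show ?thesis unfolding eq by simp
qed

text \<open>The discrete Parseval identity with noncommuting coefficients. It serves twice: averaging over diagonal
  unitaries kills the off-diagonal terms of a product, and it bounds geometric sums of an isometry from below.\<close>

lemma unity_root_parseval:
  fixes X Y :: "nat \<Rightarrow> 'a::cstar_algebra"
  shows "(\<Sum>j<n. (\<Sum>a<n. (unity_root n j ^ a) *\<^sub>C X a) * (\<Sum>b<n. cnj (unity_root n j ^ b) *\<^sub>C Y b))
    = real n *\<^sub>R (\<Sum>a<n. X a * Y a)"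
proof -
  let ?z = "\<lambda>j a b. unity_root n j ^ a * cnj (unity_root n j ^ b)"
  have "(\<Sum>j<n. (\<Sum>a<n. (unity_root n j ^ a) *\<^sub>C X a) * (\<Sum>b<n. cnj (unity_root n j ^ b) *\<^sub>C Y b))
      = (\<Sum>j<n. \<Sum>a<n. \<Sum>b<n. ?z j a b *\<^sub>C (X a * Y b))"
    by (simp add: sum_product mult_scaleC_left mult_scaleC_right scaleC_scaleC mult.commute)
  also have "\<dots> = (\<Sum>a<n. \<Sum>j<n. \<Sum>b<n. ?z j a b *\<^sub>C (X a * Y b))" by (rule sum.swap)
  also have "\<dots> = (\<Sum>a<n. \<Sum>b<n. \<Sum>j<n. ?z j a b *\<^sub>C (X a * Y b))"
    by (rule sum.cong[OF refl], rule sum.swap)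
  also have "\<dots> = (\<Sum>a<n. \<Sum>b<n. (\<Sum>j<n. ?z j a b) *\<^sub>C (X a * Y b))"
    by (simp only: cspace.scale_sum_left)
  also have "\<dots> = (\<Sum>a<n. \<Sum>b<n. if a = b then real n *\<^sub>R (X a * Y b) else 0)"
    by (intro sum.cong refl) (simp add: unity_root_orthogonal scaleR_scaleC del: complex_cnj_power)
  also have "\<dots> = real n *\<^sub>R (\<Sum>a<n. X a * Y a)" by (simp add: scaleR_sum_right)
  finally show ?thesis .
qed


section \<open>Finite orthonormal families of isometries\<close>

lemma norm_selfadjoint_power:
  assumes "adj h = (h :: 'a::cstar_algebra)"
  shows "norm (h ^ 2 ^ k) = norm h ^ 2 ^ k"
proof (induction k)
  case (Suc k)
  have "h ^ 2 ^ Suc k = adj (h ^ 2 ^ k) * h ^ 2 ^ k"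
    by (simp add: adj_power assms mult_2 flip: power_add)
  then show ?case using Suc by (simp add: cstar_identity mult.commute flip: power_mult)
qed simp

lemma le_if_powers_le:
  fixes a b C :: real
  assumes "0 \<le> a" "0 \<le> b" and le: "\<And>k. a ^ 2 ^ k \<le> C * b ^ 2 ^ k"
  shows "a \<le> b"
proof (rule ccontr)
  assume "\<not> a \<le> b"
  then have ab: "b < a" by simp
  show False
  proof (cases "b = 0")
    case True
    with le[of 0] ab show False by simp
  next
    case False
    with \<open>0 \<le> b\<close> have b: "b > 0" by simp
    with ab have "1 < a / b" by simp
    then obtain n where n: "C < (a / b) ^ n" using real_arch_pow by blast
    have "(a / b) ^ n \<le> (a / b) ^ 2 ^ n"
      using \<open>1 < a / b\<close> by (intro power_increasing) (auto intro: less_imp_le)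
    with n have "C < (a / b) ^ 2 ^ n" by simp
    with le[of n] b show False by (simp add: power_divide field_simps)
  qed
qed

text \<open>The map \<open>y \<mapsto> \<Sum>i. S i * y * adj (S i)\<close> is multiplicative and respects adjoints, and the triangle
  inequality bounds it by the factor \<open>card F\<close>. Applied to the powers \<open>h ^ 2 ^ k\<close> of a self-adjoint \<open>h\<close>, whose
  norms are the powers of \<open>norm h\<close>, this factor disappears in the \<open>2 ^ k\<close>-th root.\<close>

lemma norm_ampliation_le:
  fixes S :: "'i \<Rightarrow> 'a::cstar_algebra"
  assumes fin: "finite F"
    and orth: "\<And>i j. i \<in> F \<Longrightarrow> j \<in> F \<Longrightarrow> adj (S i) * S j = (if i = j then 1 else 0)"
  shows "norm (\<Sum>i\<in>F. S i * y * adj (S i)) \<le> norm y"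
proof -
  define \<psi> where "\<psi> y = (\<Sum>i\<in>F. S i * y * adj (S i))" for y
  have mult: "\<psi> x * \<psi> z = \<psi> (x * z)" for x z
  proof -
    have "\<psi> x * \<psi> z = (\<Sum>i\<in>F. \<Sum>j\<in>F. S i * x * (adj (S i) * S j) * z * adj (S j))"
      by (simp add: \<psi>_def sum_product mult.assoc)
    also have "\<dots> = (\<Sum>i\<in>F. \<Sum>j\<in>F. if i = j then S i * (x * z) * adj (S i) else 0)"
      by (intro sum.cong refl) (simp add: orth mult.assoc)
    finally show ?thesis by (simp add: \<psi>_def fin)
  qed
  have adj: "adj (\<psi> x) = \<psi> (adj x)" for x
    by (simp add: \<psi>_def adj_sum adj_mult adj_adj mult.assoc)
  have pow: "\<psi> h ^ Suc m = \<psi> (h ^ Suc m)" for h m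
    by (induction m) (simp_all add: mult)
  have bound: "norm (\<psi> x) \<le> real (card F) * norm x" for x
  proof -
    have "norm (S i * x * adj (S i)) \<le> norm x" if "i \<in> F" for i
    proof -
      have "norm (S i) = 1" using that orth by (intro norm_isometry) simp
      then show ?thesis
        using norm_mult_ineq[of "S i * x" "adj (S i)"] norm_mult_ineq[of "S i" x] by simp
    qed
    then show ?thesis unfolding \<psi>_def by (intro sum_norm_bound) 
  qed
  define h where "h = adj y * y"
  have sah: "adj h = h" by (simp add: h_def adj_mult adj_adj)
  have "norm (\<psi> h) \<le> norm h"
  proof (rule le_if_powers_le)
    fix k :: nat
    have "norm (\<psi> h) ^ 2 ^ k = norm (\<psi> h ^ 2 ^ k)"
      by (rule norm_selfadjoint_power[symmetric]) (simp add: adj sah)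
    also have "\<psi> h ^ 2 ^ k = \<psi> (h ^ 2 ^ k)"
      using pow[of h "2 ^ k - 1"] by simp
    also have "norm \<dots> \<le> real (card F) * norm (h ^ 2 ^ k)" by (rule bound)
    also have "norm (h ^ 2 ^ k) = norm h ^ 2 ^ k" by (rule norm_selfadjoint_power[OF sah])
    finally show "norm (\<psi> h) ^ 2 ^ k \<le> real (card F) * norm h ^ 2 ^ k" .
  qed auto
  moreover have "(norm (\<psi> y))\<^sup>2 = norm (\<psi> h)"
    by (simp add: adj mult h_def flip: cstar_identity)
  ultimately have "(norm (\<psi> y))\<^sup>2 \<le> (norm y)\<^sup>2" by (simp add: h_def cstar_identity)
  then show ?thesis unfolding \<psi>_def by (rule power2_le_imp_le) simp
qed

lemma uniform_average_in_Ave: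
  assumes fin: "finite I" and ne: "I \<noteq> {}" and u: "\<And>i. i \<in> I \<Longrightarrow> u i \<in> U"
  shows "(\<lambda>x. (1 / card I) *\<^sub>R (\<Sum>i\<in>I. u i * x * adj (u i))) \<in> Ave U"
proof -
  obtain h where h: "bij_betw h {1..card I} I" using ex_bij_betw_nat_finite_1[OF fin] by blast
  have c: "card I > 0" using fin ne by (simp add: card_gt_0_iff)
  have "(\<lambda>x. (1 / card I) *\<^sub>R (\<Sum>i\<in>I. u i * x * adj (u i)))
      = (\<lambda>x. \<Sum>i=1..card I. (1 / card I) *\<^sub>R (u (h i) * x * adj (u (h i))))"
    by (simp add: scaleR_sum_right flip: sum.reindex_bij_betw[OF h])
  moreover have "\<forall>i\<in>{1..card I}. u (h i) \<in> U" using h u by (auto simp: bij_betw_def)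
  ultimately show ?thesis unfolding Ave_def using c
    by (intro CollectI exI[of _ "card I"] exI[of _ "\<lambda>_. 1 / card I"] exI[of _ "\<lambda>i. u (h i)"]) auto
qed

lemma bij_betw_add_mod: "bij_betw (\<lambda>k. (a + k) mod n) {..<n} {..<n::nat}"
proof (cases "n = 0")
  case False
  have "inj_on (\<lambda>k. (a + k) mod n) {..<n}"
  proof (rule inj_onI)
    fix k l assume kl: "k \<in> {..<n}" "l \<in> {..<n}" "(a + k) mod n = (a + l) mod n"
    then have "(int a + int k) mod int n = (int a + int l) mod int n"
      by (metis of_nat_add of_nat_mod)
    then have "((int a + int k) - int a) mod int n = ((int a + int l) - int a) mod int n"
      by (rule mod_diff_cong) simp
    with kl show "k = l" by simp
  qed
  moreover have "(\<lambda>k. (a + k) mod n) ` {..<n} \<subseteq> {..<n}" using False by auto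
  ultimately show ?thesis by (simp add: bij_betw_def endo_inj_surj)
qed simp

text \<open>The unitaries are the Weyl matrices in the matrix units \<open>S i * adj (S j)\<close>: a cyclic shift by \<open>k\<close> times
  the diagonal matrix of the \<open>j\<close>-th powers of roots of unity. In \<open>u * x * adj u\<close>, averaging over the phases
  \<open>j\<close> leaves the terms with equal diagonal indices, and averaging over the shifts \<open>k\<close> spreads their sum evenly
  over the diagonal.\<close>

lemma matrix_unit_average_in_Ave:
  fixes S :: "'i \<Rightarrow> 'a::cstar_algebra"
  assumes fin: "finite F" and ne: "F \<noteq> {}"
    and orth: "\<And>i j. i \<in> F \<Longrightarrow> j \<in> F \<Longrightarrow> adj (S i) * S j = (if i = j then 1 else 0)"
    and complete: "(\<Sum>i\<in>F. S i * adj (S i)) = 1"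
    and sub: "cspace.subspace A"
    and units: "\<And>i j. i \<in> F \<Longrightarrow> j \<in> F \<Longrightarrow> S i * adj (S j) \<in> A"
  shows "(\<lambda>x. \<Sum>i\<in>F. S i * ((1 / card F) *\<^sub>R (\<Sum>j\<in>F. adj (S j) * x * S j)) * adj (S i))
    \<in> Ave (unitaries A)"
proof -
  define n where "n = card F"
  have n: "n > 0" using fin ne by (simp add: n_def card_gt_0_iff)
  obtain b where b: "bij_betw b {..<n} F"
    using ex_bij_betw_nat_finite[OF fin] by (auto simp: n_def atLeast0LessThan)
  define T where "T a = S (b a)" for a
  have bF: "b a \<in> F" if "a < n" for a using b that by (auto simp: bij_betw_def)
  have orthT: "adj (T a) * T c = (if a = c then 1 else 0)" if "a < n" "c < n" for a c
    using b that bF by (auto simp: T_def orth bij_betw_def inj_on_def)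
  have sumT: "(\<Sum>i\<in>F. f (S i)) = (\<Sum>a<n. f (T a))" for f :: "'a \<Rightarrow> 'a"
    using sum.reindex_bij_betw[OF b, of "\<lambda>i. f (S i)"] by (simp add: T_def)
  have compT: "(\<Sum>a<n. T a * adj (T a)) = 1"
    using complete sumT[of "\<lambda>s. s * adj s"] by simp
  define w where "w = unity_root n"
  define sh where "sh k a = (a + k) mod n" for k a
  have sh_lt: "sh k a < n" for k a using n by (simp add: sh_def)
  have sh_bij: "bij_betw (sh k) {..<n} {..<n}" "bij_betw (\<lambda>k. sh k a) {..<n} {..<n}" for k a
    using bij_betw_add_mod[of k n] bij_betw_add_mod[of a n]
    by (simp_all add: sh_def[abs_def] add.commute)
  have sh_inj: "sh k a = sh k c \<longleftrightarrow> a = c" if "a < n" "c < n" for k a c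
    using sh_bij(1)[of k] that by (auto simp: bij_betw_def inj_on_def)
  define u where "u j k = (\<Sum>a<n. (w j ^ a) *\<^sub>C (T (sh k a) * adj (T a)))" for j k
  have adju: "adj (u j k) = (\<Sum>a<n. cnj (w j ^ a) *\<^sub>C (T a * adj (T (sh k a))))" for j k
    by (simp add: u_def adj_sum adj_scaleC adj_mult adj_adj)
  have ww: "cnj (w j ^ a) * w j ^ a = 1" for j a
    by (simp add: w_def mult.commute cnj_unity_root flip: power_mult_distrib)
  have uu1: "adj (u j k) * u j k = 1" for j k
  proof -
    have "adj (u j k) * u j k = (\<Sum>a<n. \<Sum>c<n. (cnj (w j ^ a) * w j ^ c) *\<^sub>C
        (T a * (adj (T (sh k a)) * T (sh k c)) * adj (T c)))"
      unfolding adju unfolding u_def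
      by (simp add: sum_product mult_scaleC_left mult_scaleC_right scaleC_scaleC mult.assoc mult.commute)
    also have "\<dots> = (\<Sum>a<n. \<Sum>c<n. if a = c then T a * adj (T a) else 0)"
      by (intro sum.cong refl) (simp add: orthT sh_lt sh_inj ww del: complex_cnj_power)
    finally show ?thesis by (simp add: compT)
  qed
  have uu2: "u j k * adj (u j k) = 1" for j k
  proof -
    have "u j k * adj (u j k) = (\<Sum>a<n. \<Sum>c<n. (cnj (w j ^ c) * w j ^ a) *\<^sub>C
        (T (sh k a) * (adj (T a) * T c) * adj (T (sh k c))))"
      unfolding adju unfolding u_def
      by (simp add: sum_product mult_scaleC_left mult_scaleC_right scaleC_scaleC mult.assoc mult.commute)
    also have "\<dots> = (\<Sum>a<n. \<Sum>c<n. if a = c then T (sh k a) * adj (T (sh k a)) else 0)"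
      by (intro sum.cong refl) (simp add: orthT ww del: complex_cnj_power)
    also have "\<dots> = (\<Sum>a<n. T (sh k a) * adj (T (sh k a)))" by simp
    also have "\<dots> = 1" using sum.reindex_bij_betw[OF sh_bij(1)[of k], of "\<lambda>a. T a * adj (T a)"]
      by (simp add: compT)
    finally show ?thesis .
  qed
  have uA: "u j k \<in> A" for j k unfolding u_def
    by (intro cspace.subspace_sum[OF sub] cspace.subspace_scale[OF sub])
       (simp add: T_def bF sh_lt units)
  have uU: "u j k \<in> unitaries A" for j k using uu1 uu2 uA by (simp add: unitaries_def)
  have avg: "(\<Sum>(k, j)\<in>{..<n} \<times> {..<n}. u j k * x * adj (u j k))
      = real n *\<^sub>R (\<Sum>i\<in>F. S i * (\<Sum>j\<in>F. adj (S j) * x * S j) * adj (S i))" for x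
  proof -
    have "(\<Sum>(k, j)\<in>{..<n} \<times> {..<n}. u j k * x * adj (u j k))
        = (\<Sum>k<n. \<Sum>j<n. u j k * x * adj (u j k))" by (simp add: sum.cartesian_product)
    also have "\<dots> = (\<Sum>k<n. real n *\<^sub>R (\<Sum>a<n. T (sh k a) * adj (T a) * x * (T a * adj (T (sh k a)))))"
    proof (rule sum.cong[OF refl])
      fix k
      have "(\<Sum>j<n. u j k * x * adj (u j k)) =
          (\<Sum>j<n. (\<Sum>a<n. (w j ^ a) *\<^sub>C (T (sh k a) * adj (T a) * x)) *
            (\<Sum>a<n. cnj (w j ^ a) *\<^sub>C (T a * adj (T (sh k a)))))"
        unfolding adju by (simp add: u_def sum_distrib_right mult_scaleC_left)
      then show "(\<Sum>j<n. u j k * x * adj (u j k)) =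
          real n *\<^sub>R (\<Sum>a<n. T (sh k a) * adj (T a) * x * (T a * adj (T (sh k a))))"
        by (simp only: w_def unity_root_parseval)
    qed
    also have "\<dots> = real n *\<^sub>R (\<Sum>a<n. \<Sum>k<n. T (sh k a) * (adj (T a) * x * T a) * adj (T (sh k a)))"
      by (subst sum.swap) (simp add: scaleR_sum_right mult.assoc)
    also have "\<dots> = real n *\<^sub>R (\<Sum>a<n. \<Sum>c<n. T c * (adj (T a) * x * T a) * adj (T c))"
      using sum.reindex_bij_betw[OF sh_bij(2), of "\<lambda>c. T c * (adj (T a) * x * T a) * adj (T c)" for a]
      by simp
    also have "\<dots> = real n *\<^sub>R (\<Sum>c<n. T c * (\<Sum>a<n. adj (T a) * x * T a) * adj (T c))"
      by (subst sum.swap) (simp add: sum_distrib_left sum_distrib_right)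
    finally show ?thesis by (simp add: sumT[of "\<lambda>s. adj s * x * s"]
          sumT[of "\<lambda>s. s * (\<Sum>a<n. adj (T a) * x * T a) * adj s"])
  qed
  let ?I = "{..<n} \<times> {..<n}"
  have "(\<lambda>x. (1 / card ?I) *\<^sub>R (\<Sum>i\<in>?I. (case i of (k, j) \<Rightarrow> u j k) * x * adj (case i of (k, j) \<Rightarrow> u j k)))
      \<in> Ave (unitaries A)"
    using n uU by (intro uniform_average_in_Ave) auto
  moreover have "(1 / card ?I) *\<^sub>R (\<Sum>i\<in>?I. (case i of (k, j) \<Rightarrow> u j k) * x * adj (case i of (k, j) \<Rightarrow> u j k))
      = (\<Sum>i\<in>F. S i * ((1 / card F) *\<^sub>R (\<Sum>j\<in>F. adj (S j) * x * S j)) * adj (S i))" for x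
    using avg[of x] n
    by (simp add: case_prod_unfold n_def[symmetric] scaleR_sum_right[symmetric])
  ultimately show ?thesis by simp
qed


section \<open>Central unitaries of a simple algebra\<close>

lemma subspace_closure:
  fixes V :: "'a::cstar_algebra set"
  assumes V: "cspace.subspace V"
  shows "cspace.subspace (closure V)"
proof (rule cspace.subspaceI)
  show "0 \<in> closure V" using cspace.subspace_0[OF V] closure_subset by blast
  show "x + y \<in> closure V" if xy: "x \<in> closure V" "y \<in> closure V" for x y
  proof -
    obtain f g where "\<forall>n. f n \<in> V" "f \<longlonglongrightarrow> x" "\<forall>n. g n \<in> V" "g \<longlonglongrightarrow> y"
      using xy by (auto simp: closure_sequential)
    then show ?thesis unfolding closure_sequential
      by (intro exI[of _ "\<lambda>n. f n + g n"]) (auto intro: tendsto_add cspace.subspace_add[OF V])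
  qed
  show "c *\<^sub>C x \<in> closure V" if x: "x \<in> closure V" for c x
  proof -
    obtain f where "\<forall>n. f n \<in> V" "f \<longlonglongrightarrow> x" using x by (auto simp: closure_sequential)
    then show ?thesis unfolding closure_sequential
      by (intro exI[of _ "\<lambda>n. c *\<^sub>C f n"]) (auto intro: tendsto_intros cspace.subspace_scale[OF V])
  qed
qed

lemma geometric_sum_telescope:
  "(\<Sum>i<n. x ^ i) * (1 - x) = 1 - (x :: 'b::ring_1) ^ n"
proof (induction n)
  case (Suc n)
  have "(\<Sum>i<Suc n. x ^ i) * (1 - x) = (\<Sum>i<n. x ^ i) * (1 - x) + (x ^ n - x ^ n * x)"
    by (simp add: distrib_right right_diff_distrib)
  also have "\<dots> = 1 - x ^ Suc n" unfolding Suc by (simp add: power_commutes)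
  finally show ?case .
qed simp

text \<open>By the Parseval identity, the squares of these sums over all \<open>n\<close>-th roots of unity \<open>z\<close> add up to \<open>n\<^sup>2\<close>,
  so one of the \<open>n\<close> squares has norm at least \<open>n\<close>.\<close>

lemma isometry_geometric_sum_large:
  fixes W :: "'a::cstar_algebra"
  assumes W: "adj W * W = 1" and n: "n > 0"
  shows "\<exists>z. cmod z = 1 \<and> real n \<le> (norm (\<Sum>k<n. (z *\<^sub>C W) ^ k))\<^sup>2"
proof -
  define B where "B j = (\<Sum>k<n. cnj (unity_root n j ^ k) *\<^sub>C W ^ k)" for j
  have scaleC_power: "(z *\<^sub>C W) ^ k = (z ^ k) *\<^sub>C W ^ k" for z k
    by (induction k) (auto simp: mult_scaleC_left mult_scaleC_right scaleC_scaleC mult.commute)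
  have B_eq: "B j = (\<Sum>k<n. (cnj (unity_root n j) *\<^sub>C W) ^ k)" for j
    by (simp add: B_def scaleC_power)
  have "(\<Sum>j<n. adj (B j) * B j) = real n *\<^sub>R (\<Sum>k<n. adj (W ^ k) * W ^ k)"
    unfolding unity_root_parseval[symmetric]
    by (simp add: B_def adj_sum adj_scaleC)
  also have "\<dots> = (real n * real n) *\<^sub>R 1" by (simp add: isometry_power[OF W] scaleR_conv_of_real)
  finally have "real n * real n = norm (\<Sum>j<n. adj (B j) * B j)" by simp
  also have "\<dots> \<le> (\<Sum>j<n. norm (adj (B j) * B j))" by (rule norm_sum)
  finally have le: "real n * real n \<le> (\<Sum>j<n. (norm (B j))\<^sup>2)" by (simp add: cstar_identity)
  have "\<exists>j<n. real n \<le> (norm (B j))\<^sup>2"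
  proof (rule ccontr)
    assume "\<not> (\<exists>j<n. real n \<le> (norm (B j))\<^sup>2)"
    then have "(\<Sum>j<n. (norm (B j))\<^sup>2) < (\<Sum>j<n. real n)"
      using n by (intro sum_strict_mono) auto
    with le show False by simp
  qed
  then obtain j where "real n \<le> (norm (B j))\<^sup>2" by blast
  then show ?thesis unfolding B_eq by (intro exI[of _ "cnj (unity_root n j)"]) simp
qed

text \<open>This is the existence of a spectral value, by an elementary argument. Choose for each length \<open>n\<close> a point \<open>z\<close> of the
  circle at which the geometric sum of \<open>z W\<close> has norm at least \<open>sqrt n\<close>, and let \<open>l\<close> be an accumulation
  point. If \<open>1 - l W\<close> had an approximate right inverse \<open>y\<close>, then telescoping would bound the geometric sums
  of \<open>z W\<close> by \<open>8 norm y\<close> for all \<open>z\<close> near \<open>l\<close>, independently of their length.\<close>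

lemma isometry_circle_spectrum_nonempty:
  fixes W :: "'a::cstar_algebra"
  assumes W: "adj W * W = 1"
  shows "\<exists>z. cmod z = 1 \<and> (\<forall>y. 1/2 \<le> norm (1 - (1 - z *\<^sub>C W) * y))"
proof -
  obtain z where z: "\<And>n. cmod (z n) = 1"
    and large: "\<And>n. real (Suc n) \<le> (norm (\<Sum>k<Suc n. (z n *\<^sub>C W) ^ k))\<^sup>2"
  proof -
    have "\<forall>n. \<exists>z. cmod z = 1 \<and> real (Suc n) \<le> (norm (\<Sum>k<Suc n. (z *\<^sub>C W) ^ k))\<^sup>2"
      using isometry_geometric_sum_large[OF W zero_less_Suc] by blast
    then show thesis using that by metis
  qed
  have "seq_compact (sphere 0 1 :: complex set)"
    using compact_imp_seq_compact compact_sphere by blast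
  then obtain l r where l: "l \<in> sphere 0 1" and r: "strict_mono (r :: nat \<Rightarrow> nat)" and lim: "(z \<circ> r) \<longlonglongrightarrow> l"
    using z unfolding seq_compact_def by (metis (no_types, lifting) mem_sphere_0)
  have "1/2 \<le> norm (1 - (1 - l *\<^sub>C W) * y)" for y
  proof (rule ccontr)
    assume "\<not> ?thesis"
    then have y: "norm (1 - (1 - l *\<^sub>C W) * y) < 1/2" by simp
    have nW: "norm W = 1" by (rule norm_isometry[OF W])
    have small: "norm (\<Sum>k<n. (c *\<^sub>C W) ^ k) \<le> 8 * norm y"
      if c: "cmod c = 1" and cl: "cmod (c - l) * norm y \<le> 1/4" for c n
    proof -
      define B where "B = (\<Sum>k<n. (c *\<^sub>C W) ^ k)"
      have "norm ((c *\<^sub>C W) ^ n) \<le> 1"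
        using norm_power_ineq[of "c *\<^sub>C W" n] by (simp add: norm_scaleC c nW)
      then have 1: "norm (B * (1 - c *\<^sub>C W)) \<le> 2"
        unfolding B_def geometric_sum_telescope
        using norm_triangle_ineq4[of 1 "(c *\<^sub>C W) ^ n"] by simp
      have 2: "norm ((c - l) *\<^sub>C (B * W)) \<le> cmod (c - l) * norm B"
        using norm_mult_ineq[of B W] by (simp add: norm_scaleC nW mult_left_mono)
      have "B * (1 - l *\<^sub>C W) = B * (1 - c *\<^sub>C W) + (c - l) *\<^sub>C (B * W)"
        by (simp add: algebra_simps mult_scaleC_right cspace.scale_left_diff_distrib)
      then have 3: "norm (B * (1 - l *\<^sub>C W)) \<le> 2 + cmod (c - l) * norm B"
        using 1 2 norm_triangle_ineq[of "B * (1 - c *\<^sub>C W)" "(c - l) *\<^sub>C (B * W)"] by simp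
      have "B = B * (1 - (1 - l *\<^sub>C W) * y) + B * (1 - l *\<^sub>C W) * y" by (simp add: algebra_simps)
      then have "norm B \<le> norm (B * (1 - (1 - l *\<^sub>C W) * y)) + norm (B * (1 - l *\<^sub>C W) * y)"
        by (metis norm_triangle_ineq)
      also have "\<dots> \<le> norm B * (1/2) + (2 + cmod (c - l) * norm B) * norm y"
        using norm_mult_ineq[of B "1 - (1 - l *\<^sub>C W) * y"] norm_mult_ineq[of "B * (1 - l *\<^sub>C W)" y]
          mult_left_mono[OF less_imp_le[OF y], of "norm B"] mult_right_mono[OF 3, of "norm y"] by simp
      also have "\<dots> = norm B * (1/2) + 2 * norm y + norm B * (cmod (c - l) * norm y)"
        by (simp add: algebra_simps)
      also have "\<dots> \<le> norm B * (1/2) + 2 * norm y + norm B * (1/4)"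
        using mult_left_mono[OF cl, of "norm B"] by simp
      finally show ?thesis by (simp add: B_def)
    qed
    have "(\<lambda>n. cmod ((z \<circ> r) n - l) * norm y) \<longlonglongrightarrow> cmod (l - l) * norm y"
      by (intro tendsto_intros lim)
    then have "\<forall>\<^sub>F n in sequentially. cmod ((z \<circ> r) n - l) * norm y < 1/4"
      by (rule order_tendstoD) simp
    moreover have "\<forall>\<^sub>F n in sequentially. (8 * norm y)\<^sup>2 < real n"
      using filterlim_real_sequentially by (simp add: filterlim_at_top_dense)
    ultimately have "\<forall>\<^sub>F n in sequentially. False"
    proof eventually_elim
      case (elim n)
      have "real n \<le> real (Suc (r n))" using seq_suble[OF r, of n] by simp
      also have "\<dots> \<le> (norm (\<Sum>k<Suc (r n). (z (r n) *\<^sub>C W) ^ k))\<^sup>2" by (rule large)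
      also have "\<dots> \<le> (8 * norm y)\<^sup>2"
        using elim(1) z by (intro power_mono small) auto
      finally show False using elim(2) by simp
    qed
    then show False by simp
  qed
  with l show ?thesis by auto
qed

text \<open>For a spectral value given by the previous lemma, the closure of the multiples of \<open>V = 1 - z W\<close> is an ideal,
  because \<open>V\<close> is central, and it stays at distance \<open>1/2\<close> from 1. Hence it is zero.\<close>

lemma simple_central_unitary_scalar:
  fixes W :: "'a::cstar_algebra"
  assumes simple: "simple_cstar (UNIV :: 'a set)"
    and W: "adj W * W = 1" and central: "\<And>x. W * x = x * W"
  shows "\<exists>c. W = c *\<^sub>C 1"
proof -
  obtain z where z: "cmod z = 1" and far: "\<And>y. 1/2 \<le> norm (1 - (1 - z *\<^sub>C W) * y)"
    using isometry_circle_spectrum_nonempty[OF W] by blast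
  define V where "V = 1 - z *\<^sub>C W"
  have V_central: "V * x = x * V" for x
    by (simp add: V_def algebra_simps mult_scaleC_left mult_scaleC_right central)
  define J where "J = closure (range ((*) V))"
  have sub: "cspace.subspace (range ((*) V))"
  proof (rule cspace.subspaceI)
    show "0 \<in> range ((*) V)" by (rule image_eqI[of _ _ 0]) auto
  next
    fix x y assume "x \<in> range ((*) V)" "y \<in> range ((*) V)"
    then show "x + y \<in> range ((*) V)" by (auto simp flip: distrib_left)
  next
    fix c x assume "x \<in> range ((*) V)"
    then show "c *\<^sub>C x \<in> range ((*) V)" by (auto simp flip: mult_scaleC_right)
  qed
  have ideal: "a * x \<in> J \<and> x * a \<in> J" if xJ: "x \<in> J" for a x
  proof -
    have "\<exists>f. (\<forall>n. f n \<in> range ((*) V)) \<and> f \<longlonglongrightarrow> x"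
      using xJ by (simp only: J_def closure_sequential)
    then obtain f where f: "(\<forall>n. f n \<in> range ((*) V)) \<and> f \<longlonglongrightarrow> x" ..
    have "a * f n \<in> range ((*) V)" "f n * a \<in> range ((*) V)" for n
    proof -
      have "f n \<in> range ((*) V)" using f by simp
      then obtain y where y: "f n = V * y" ..
      have "a * f n = (a * V) * y" unfolding y by (simp only: mult.assoc)
      also have "\<dots> = V * (a * y)" by (simp only: V_central[of a, symmetric] mult.assoc)
      finally have 1: "a * f n = V * (a * y)" .
      have 2: "f n * a = V * (y * a)" unfolding y by (simp only: mult.assoc)
      from 1 2 show "a * f n \<in> range ((*) V)" "f n * a \<in> range ((*) V)" by simp_all
    qed
    moreover have "(\<lambda>n. a * f n) \<longlonglongrightarrow> a * x" "(\<lambda>n. f n * a) \<longlonglongrightarrow> x * a"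
      using f by (simp_all add: tendsto_mult_left tendsto_mult_right)
    ultimately have "a * x \<in> closure (range ((*) V))" "x * a \<in> closure (range ((*) V))"
      unfolding closure_sequential
       apply -
       apply (rule exI[of _ "\<lambda>n. a * f n"], simp)
      apply (rule exI[of _ "\<lambda>n. f n * a"], simp)
      done
    then show ?thesis by (simp add: J_def)
  qed
  have "closed_ideal UNIV J"
    using ideal subspace_closure[OF sub] by (simp add: closed_ideal_def J_def)
  moreover have "J \<noteq> UNIV"
  proof
    assume "J = UNIV"
    then have "1 \<in> closure (range ((*) V))" by (simp add: J_def)
    then have "\<forall>e>0. \<exists>x\<in>range ((*) V). dist x 1 < e" by (simp only: closure_approachable)
    moreover have "(0::real) < 1/2" by simp
    ultimately have "\<exists>x\<in>range ((*) V). dist x 1 < 1/2" by (elim allE impE)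
    then obtain y where "dist (V * y) 1 < 1/2" by (elim bexE rangeE) simp
    with far[of y] show False by (simp add: V_def dist_norm norm_minus_commute)
  qed
  ultimately have "J = {0}" using simple by (auto simp: simple_cstar_def)
  moreover have "V * 1 \<in> J" unfolding J_def by (rule subsetD[OF closure_subset rangeI])
  ultimately have "z *\<^sub>C W = 1" by (simp add: V_def)
  then have "inverse z *\<^sub>C (z *\<^sub>C W) = inverse z *\<^sub>C 1" by simp
  moreover have "z \<noteq> 0" using z by auto
  ultimately have "W = inverse z *\<^sub>C 1" by (simp add: scaleC_scaleC)
  then show ?thesis by blast
qed


section \<open>Degrees and factorizations\<close>

definition unit_degree :: "'k \<Rightarrow> nat ^ 'k" where
  "unit_degree i = axis i 1"

lemma unit_degree_nth [simp]: "unit_degree i $ j = (if j = i then 1 else 0)"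
  by (simp add: unit_degree_def axis_def)

lemma edges_iff: "e \<in> edges d i \<longleftrightarrow> d e = unit_degree i"
  by (simp add: edges_def unit_degree_def)

lemma degree_split:
  assumes "(p :: nat ^ 'k) $ i > 0"
  obtains q where "p = unit_degree i + q"
proof
  show "p = unit_degree i + (p - unit_degree i)"
    using assms by (auto simp: vec_eq_iff)
qed

lemma degree_induct [case_names zero add]:
  fixes p :: "nat ^ 'k"
  assumes "P 0" and "\<And>i q. P q \<Longrightarrow> P (unit_degree i + q)"
  shows "P p"
proof (induction "\<Sum>i\<in>UNIV. p $ i" arbitrary: p)
  case 0
  then have "p = 0" by (simp add: vec_eq_iff)
  then show ?case using assms(1) by simp
next
  case (Suc n)
  have "\<exists>i. p $ i > 0"
  proof (rule ccontr)
    assume "\<not> ?thesis"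
    then have "\<And>i. p $ i = 0" by auto
    with Suc.hyps(2) show False by simp
  qed
  then obtain i where "p $ i > 0" by blast
  then obtain q where q: "p = unit_degree i + q" by (rule degree_split)
  have "(\<Sum>j\<in>UNIV. p $ j) = 1 + (\<Sum>j\<in>UNIV. q $ j)"
    by (simp add: q sum.distrib)
  with Suc.hyps(2) have "P q" by (intro Suc.hyps(1)) simp
  then show ?case unfolding q by (rule assms(2))
qed

context single_vertex_kgraph
begin

abbreviation all_edges :: "'l set" where
  "all_edges \<equiv> \<Union>i. edges d i"

definition level where
  "level p = {l. d l = p}"

lemma edges_eq_level: "edges d i = level (unit_degree i)"
  by (auto simp: edges_iff level_def)

lemma edge_degree: "e \<in> edges d i \<Longrightarrow> d e = unit_degree i"
  by (simp add: edges_iff)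

lemma factor_exists:
  assumes "d l = p + q"
  obtains m n where "l = m * n" "d m = p" "d n = q"
  using factorization[OF assms] by auto

lemma factor_unique:
  assumes "a * b = a' * b'" and "d a = d a'"
  shows "a = a' \<and> b = b'"
proof -
  have "d a + d b = d a + d b'" using assms by (metis degree_mult)
  then have "d b = d b'" by simp
  obtain y where y: "\<And>x. (case x of (m, n) \<Rightarrow> a * b = m * n \<and> d m = d a \<and> d n = d b) \<Longrightarrow> x = y"
    using factorization[OF degree_mult, of a b] by (elim ex1E) blast
  have "(a, b) = y" by (rule y) simp
  moreover have "(a', b') = y" by (rule y) (simp add: assms \<open>d b = d b'\<close>)
  ultimately have "(a, b) = (a', b')" by simp
  then show ?thesis by simp
qed

lemma degree_zero_iff: "d l = 0 \<longleftrightarrow> l = 1"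
  using factor_unique[of l 1 1 l] by (metis degree_one mult_1 mult_1_right)

lemma factor_edge:
  assumes "d l $ i > 0"
  obtains e m where "l = e * m" "e \<in> edges d i" "d l = unit_degree i + d m"
proof -
  obtain q where q: "d l = unit_degree i + q" using assms by (rule degree_split)
  then obtain e m where "l = e * m" "d e = unit_degree i" "d m = q" by (rule factor_exists)
  with q that show thesis by (auto simp: edges_iff)
qed

lemma edge_induct [case_names one mult]:
  assumes "P 1" and "\<And>i e l. e \<in> edges d i \<Longrightarrow> P l \<Longrightarrow> P (e * l)"
  shows "P l"
proof (induction "d l" arbitrary: l rule: degree_induct)
  case zero
  then show ?case using assms(1) by (metis degree_zero_iff)
next
  case (add i q)
  obtain e m where "l = e * m" "d e = unit_degree i" "d m = q"
    using add(2)[symmetric] by (rule factor_exists)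
  with add(1) assms(2) show ?case by (auto simp: edges_iff)
qed

lemma bij_betw_level_mult:
  "bij_betw (\<lambda>(a, b). a * b) (level p \<times> level q) (level (p + q))"
proof (rule bij_betw_imageI)
  show "inj_on (\<lambda>(a, b). a * b) (level p \<times> level q)"
    by (auto simp: inj_on_def level_def dest!: factor_unique)
  show "(\<lambda>(a, b). a * b) ` (level p \<times> level q) = level (p + q)"
  proof (intro equalityI subsetI)
    fix l assume "l \<in> level (p + q)"
    then have "d l = p + q" by (simp add: level_def)
    then obtain a b where "l = a * b" "d a = p" "d b = q" by (rule factor_exists)
    then show "l \<in> (\<lambda>(a, b). a * b) ` (level p \<times> level q)"
      by (force simp: level_def)
  qed (auto simp: level_def degree_mult)
qed

lemma sum_level_add:
  "(\<Sum>l\<in>level (p + q). f l) = (\<Sum>a\<in>level p. \<Sum>b\<in>level q. f (a * b))"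
  by (simp add: sum.cartesian_product case_prod_unfold
      flip: sum.reindex_bij_betw[OF bij_betw_level_mult])

lemma level_zero: "level 0 = {1}"
  by (auto simp: level_def degree_zero_iff)

lemma finite_level: "finite (level p)"
proof (induction p rule: degree_induct)
  case (add i q)
  have "finite (edges d i \<times> level q)" using add finite_edges by simp
  then show ?case unfolding edges_eq_level by (rule bij_betw_finite[OF bij_betw_level_mult, THEN iffD1])
qed (simp add: level_zero)

lemma card_level_add: "card (level (p + q)) = card (level p) * card (level q)"
  using bij_betw_same_card[OF bij_betw_level_mult] by (metis card_cartesian_product)

lemma word_exists: "\<exists>w. set w \<subseteq> all_edges \<and> prod_list w = l"
proof (induction l rule: edge_induct)
  case one
  show ?case by (rule exI[of _ "[]"]) simp
next
  case (mult i e l)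
  then obtain w where "set w \<subseteq> all_edges" "prod_list w = l" by blast
  with mult(1) show ?case by (intro exI[of _ "e # w"]) auto
qed

lemma length_word: "set w \<subseteq> all_edges \<Longrightarrow> length w = (\<Sum>i\<in>UNIV. d (prod_list w) $ i)"
proof (induction w)
  case (Cons e w)
  then obtain i where "d e = unit_degree i" by (auto simp: edges_iff)
  with Cons show ?case by (simp add: degree_mult sum.distrib)
qed (simp add: degree_one)

end


section \<open>The isometries of a Cuntz-type representation\<close>

locale kgraph_isometries = single_vertex_kgraph d
  for d :: "'l::monoid_mult \<Rightarrow> nat ^ 'k::{finite,linorder}" +
  fixes s :: "'l \<Rightarrow> 'a::cstar_algebra"
  assumes edge_orthonormal: "\<And>i e f. e \<in> edges d i \<Longrightarrow> f \<in> edges d i \<Longrightarrow>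
      adj (s e) * s f = (if e = f then 1 else 0)"
    and edge_complete: "\<And>i. (\<Sum>e\<in>edges d i. s e * adj (s e)) = 1"
    and edge_relation: "\<And>i j e f e' f'. i \<noteq> j \<Longrightarrow> e \<in> edges d i \<Longrightarrow> f \<in> edges d j \<Longrightarrow>
      e' \<in> edges d i \<Longrightarrow> f' \<in> edges d j \<Longrightarrow> e * f = f' * e' \<Longrightarrow> s e * s f = s f' * s e'"
begin

text \<open>If two words for the same element start with edges of the same colour, unique factorization cancels
  them. Otherwise the element has both colours, hence starts with a two-coloured square
  \<open>e * f = e' * e1\<close> followed by some \<open>m\<close>. The induction hypothesis rewrites the two tails to \<open>f\<close>, respectively
  \<open>e1\<close>, followed by the same word for \<open>m\<close>, and the relation for the square closes the gap.\<close>

lemma gen_word_unique: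
  assumes "set u \<subseteq> all_edges" "set v \<subseteq> all_edges" "prod_list u = prod_list v"
  shows "gen_word s u = gen_word s v"
  using assms
proof (induction "length u" arbitrary: u v rule: less_induct)
  case less
  have len: "length u = length v"
    using length_word[OF less.prems(1)] length_word[OF less.prems(2)] less.prems(3) by simp
  show ?case
  proof (cases u)
    case Nil
    with len show ?thesis by simp
  next
    case (Cons e w)
    with len obtain e' w' where v: "v = e' # w'" by (cases v) auto
    obtain i j where e: "e \<in> edges d i" and e': "e' \<in> edges d j"
      using less.prems(1,2) by (auto simp: Cons v)
    have w: "set w \<subseteq> all_edges" and w': "set w' \<subseteq> all_edges"
      using less.prems(1,2) by (auto simp: Cons v)
    have eq: "e * prod_list w = e' * prod_list w'" using less.prems(3) by (simp add: Cons v)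
    show ?thesis
    proof (cases "i = j")
      case True
      with e e' factor_unique[OF eq] have "e = e'" "prod_list w = prod_list w'"
        by (auto simp: edges_iff)
      with less.hyps[OF _ w w'] show ?thesis by (simp add: Cons v gen_word_def)
    next
      case False
      have dd: "unit_degree i + d (prod_list w) = unit_degree j + d (prod_list w')"
        using e e' arg_cong[OF eq, of d] by (simp add: degree_mult edge_degree)
      then have "(unit_degree i + d (prod_list w)) $ j = (unit_degree j + d (prod_list w')) $ j"
        by simp
      then have "d (prod_list w) $ j > 0" using False by (simp add:)
      then obtain f m where f: "prod_list w = f * m" "f \<in> edges d j"
        by (rule factor_edge)
      have "d (e * f) = unit_degree j + unit_degree i"
        using e f(2) by (simp add: degree_mult edge_degree add.commute)
      then obtain f1 e1 where 1: "e * f = f1 * e1" "d f1 = unit_degree j" "d e1 = unit_degree i"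
        by (rule factor_exists)
      have "f1 * (e1 * m) = e' * prod_list w'"
        using eq by (simp add: f(1) 1(1) flip: mult.assoc)
      then have f1: "f1 = e'" and w'_eq: "e1 * m = prod_list w'"
        using factor_unique[of f1 "e1 * m" e' "prod_list w'"] 1(2) e' by (auto simp: edge_degree)
      obtain z where z: "set z \<subseteq> all_edges" "prod_list z = m" using word_exists by blast
      have e1: "e1 \<in> edges d i" using 1(3) by (simp add: edges_iff)
      have fz: "set (f # z) \<subseteq> all_edges" "set (e1 # z) \<subseteq> all_edges" using f(2) e1 z by auto
      have "gen_word s w = gen_word s (f # z)"
        using less.hyps[OF _ w fz(1)] f z by (simp add: Cons)
      moreover have "length (e1 # z) = length w'"
        using length_word[OF fz(2)] length_word[OF w'] w'_eq z(2) by simp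
      then have "gen_word s (e1 # z) = gen_word s w'"
        using less.hyps[OF _ fz(2) w'] w'_eq z(2) len by (simp add: Cons v)
      moreover have "s e * s f = s e' * s e1"
        using edge_relation[OF False e f(2) e1 e'] 1(1) f1 by simp
      ultimately show ?thesis
        by (simp add: Cons v gen_word_def flip: mult.assoc) (metis mult.assoc)
    qed
  qed
qed

definition S :: "'l \<Rightarrow> 'a" where
  "S l = gen_word s (SOME w. set w \<subseteq> all_edges \<and> prod_list w = l)"

lemma gen_word_eq_S: "set w \<subseteq> all_edges \<Longrightarrow> gen_word s w = S (prod_list w)"
  unfolding S_def
  using someI[of "\<lambda>u. set u \<subseteq> all_edges \<and> prod_list u = prod_list w" w]
  by (intro gen_word_unique) auto

lemma S_one [simp]: "S 1 = 1"
  using gen_word_eq_S[of "[]"] by (simp add: gen_word_def)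

lemma S_mult: "S (a * b) = S a * S b"
proof -
  obtain u v where "set u \<subseteq> all_edges" "prod_list u = a" "set v \<subseteq> all_edges" "prod_list v = b"
    using word_exists by metis
  then show ?thesis
    using gen_word_eq_S[of u] gen_word_eq_S[of v] gen_word_eq_S[of "u @ v"]
    by (simp add: gen_word_def)
qed

lemma S_edge: "e \<in> edges d i \<Longrightarrow> S e = s e"
proof -
  assume "e \<in> edges d i"
  then have "set [e] \<subseteq> all_edges" by auto
  from gen_word_eq_S[OF this] show ?thesis by (simp add: gen_word_def)
qed

lemma S_orthonormal:
  "d a = p \<Longrightarrow> d b = p \<Longrightarrow> adj (S a) * S b = (if a = b then 1 else 0)"
proof (induction p arbitrary: a b rule: degree_induct)
  case zero
  then show ?case by (simp add: degree_zero_iff)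
next
  case (add i q)
  obtain e a' where a: "a = e * a'" "d e = unit_degree i" "d a' = q"
    using add.prems(1) by (rule factor_exists)
  obtain f b' where b: "b = f * b'" "d f = unit_degree i" "d b' = q"
    using add.prems(2) by (rule factor_exists)
  have ef: "e \<in> edges d i" "f \<in> edges d i" using a b by (auto simp: edges_iff)
  have "adj (S a) * S b = adj (S a') * (adj (s e) * s f) * S b'"
    using ef by (simp add: a b S_mult S_edge adj_mult mult.assoc)
  moreover have "a = b \<longleftrightarrow> e = f \<and> a' = b'"
    using factor_unique[of e a' f b'] a b by auto
  ultimately show ?case using add.IH[OF a(3) b(3)] ef by (auto simp: edge_orthonormal)
qed

lemma S_isometry: "adj (S a) * S a = 1"
  by (simp add: S_orthonormal)

lemma norm_S: "norm (S a) = 1"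
  by (rule norm_isometry[OF S_isometry])

lemma S_complete: "(\<Sum>l\<in>level p. S l * adj (S l)) = 1"
proof (induction p rule: degree_induct)
  case (add i q)
  have "(\<Sum>l\<in>level (unit_degree i + q). S l * adj (S l))
      = (\<Sum>e\<in>edges d i. S e * (\<Sum>b\<in>level q. S b * adj (S b)) * adj (S e))"
    unfolding sum_level_add edges_eq_level
    by (simp add: S_mult adj_mult mult.assoc sum_distrib_left sum_distrib_right)
  also have "\<dots> = (\<Sum>e\<in>edges d i. s e * adj (s e))"
    by (intro sum.cong refl) (simp add: add S_edge)
  finally show ?case by (simp add: edge_complete)
qed (simp add: level_zero)

lemma card_level_pos: "card (level p) > 0"
proof -
  have "level p \<noteq> {}" using S_complete[of p] by auto
  then show ?thesis by (simp add: card_gt_0_iff finite_level)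
qed

lemma level_orthonormal:
  "a \<in> level p \<Longrightarrow> b \<in> level p \<Longrightarrow> adj (S a) * S b = (if a = b then 1 else 0)"
  by (simp add: level_def S_orthonormal)

text \<open>A product \<open>adj (S v) * S w\<close> is evaluated by inserting the partition of unity of a level \<open>p\<close> that is large enough for
  its elements to have prefixes of the degrees of both \<open>v\<close> and \<open>w\<close>.\<close>

lemma adj_S_mult_S_expand:
  "adj (S v) * S w = (\<Sum>l\<in>level p. adj (S v) * S l * (adj (S l) * S w))"
proof -
  have "adj (S v) * S w = adj (S v) * (\<Sum>l\<in>level p. S l * adj (S l)) * S w"
    by (simp add: S_complete)
  then show ?thesis by (simp add: sum_distrib_left sum_distrib_right mult.assoc)
qed

lemma adj_S_mult_S_prefix:
  assumes "d a = d v"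
  shows "adj (S v) * S (a * b) = (if a = v then S b else 0)"
proof -
  have "adj (S v) * S (a * b) = adj (S v) * S a * S b" by (simp add: S_mult mult.assoc)
  then show ?thesis using S_orthonormal[of v "d v" a] assms by auto
qed

lemma adj_S_prefix_mult_S:
  assumes "d a = d w"
  shows "adj (S (a * b)) * S w = (if a = w then adj (S b) else 0)"
  using arg_cong[OF adj_S_mult_S_prefix[OF assms, of b], of adj]
  by (simp add: adj_mult adj_adj split: if_splits)

definition monomials :: "'a set" where
  "monomials = {S u * adj (S v) | u v. True}"

definition monomial_span :: "'a set" where
  "monomial_span = cspace.span monomials"

lemma adj_S_mult_S_in_span: "adj (S v) * S w \<in> monomial_span"
proof -
  have "adj (S v) * S l * (adj (S l) * S w) \<in> monomial_span" if l: "l \<in> level (d v + d w)" for l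
  proof -
    have dl: "d l = d v + d w" "d l = d w + d v" using l by (simp_all add: level_def add.commute)
    obtain a b where a: "l = a * b" "d a = d v" using dl(1) by (rule factor_exists)
    obtain a' b' where a': "l = a' * b'" "d a' = d w" using dl(2) by (rule factor_exists)
    have "S b * adj (S b') \<in> monomial_span"
      unfolding monomial_span_def monomials_def by (intro cspace.span_base) blast
    moreover have "0 \<in> monomial_span" by (simp add: monomial_span_def cspace.span_zero)
    ultimately show ?thesis
      using adj_S_mult_S_prefix[OF a(2), of b] adj_S_prefix_mult_S[OF a'(2), of b'] a(1) a'(1)
      by auto
  qed
  then show ?thesis
    unfolding adj_S_mult_S_expand[of v w "d v + d w"] monomial_span_def
    by (intro cspace.span_sum) (simp flip: monomial_span_def)
qed

lemma monomial_span_sandwich: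
  assumes "x \<in> monomial_span"
  shows "S a * x * adj (S b) \<in> monomial_span"
  using assms unfolding monomial_span_def
proof (induction rule: cspace.span_induct_alt)
  case base
  show ?case by (simp add: cspace.span_zero)
next
  case (step c x y)
  have "S a * x * adj (S b) \<in> monomials"
  proof -
    obtain u v where "x = S u * adj (S v)" using step(1) by (auto simp: monomials_def)
    then have "S a * x * adj (S b) = S (a * u) * adj (S (b * v))"
      by (simp add: S_mult adj_mult mult.assoc)
    then show ?thesis by (auto simp: monomials_def)
  qed
  then have "c *\<^sub>C (S a * x * adj (S b)) + S a * y * adj (S b) \<in> cspace.span monomials"
    using step(2) by (simp add: cspace.span_add cspace.span_scale cspace.span_base)
  then show ?case by (simp add: algebra_simps mult_scaleC_left mult_scaleC_right)
qed

lemma monomial_span_mult: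
  assumes "x \<in> monomial_span" "y \<in> monomial_span"
  shows "x * y \<in> monomial_span"
proof -
  have mm: "x * y \<in> monomial_span" if xy: "x \<in> monomials" "y \<in> monomials" for x y
  proof -
    obtain u v u' v' where "x = S u * adj (S v)" "y = S u' * adj (S v')"
      using xy unfolding monomials_def by blast
    then show ?thesis
      using monomial_span_sandwich[OF adj_S_mult_S_in_span[of v u'], of u v']
      by (simp add: mult.assoc)
  qed
  have my: "x * y \<in> monomial_span" if x: "x \<in> monomials" for x
    using assms(2) unfolding monomial_span_def
  proof (induction rule: cspace.span_induct_alt)
    case (step c z y)
    then have "c *\<^sub>C (x * z) + x * y \<in> cspace.span monomials"
      using mm[OF x step(1)] by (intro cspace.span_add cspace.span_scale) (simp_all add: monomial_span_def)
    then show ?case by (simp add: distrib_left mult_scaleC_right)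
  qed (simp add: cspace.span_zero)
  show ?thesis using assms(1) unfolding monomial_span_def
  proof (induction rule: cspace.span_induct_alt)
    case (step c z x)
    then have "c *\<^sub>C (z * y) + x * y \<in> cspace.span monomials"
      using my[OF step(1)] by (intro cspace.span_add cspace.span_scale) (simp_all add: monomial_span_def)
    then show ?case by (simp add: distrib_right mult_scaleC_left)
  qed (simp add: cspace.span_zero)
qed

lemma monomial_span_adj:
  assumes "x \<in> monomial_span"
  shows "adj x \<in> monomial_span"
  using assms unfolding monomial_span_def
proof (induction rule: cspace.span_induct_alt)
  case (step c z y)
  obtain u v where "z = S u * adj (S v)" using step(1) unfolding monomials_def by blast
  then have "adj z = S v * adj (S u)" by (simp add: adj_mult adj_adj)
  then have "adj z \<in> monomials" unfolding monomials_def by blast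
  then have "cnj c *\<^sub>C adj z + adj y \<in> cspace.span monomials"
    using step(2) by (simp add: cspace.span_add cspace.span_scale cspace.span_base)
  then show ?case by (simp add: adj_add adj_scaleC)
qed (simp add: cspace.span_zero)

lemma closure_monomial_span_subalgebra: "unital_cstar_subalgebra (closure monomial_span)"
proof -
  have sub: "cspace.subspace monomial_span" unfolding monomial_span_def by simp
  have one: "1 \<in> monomial_span"
    unfolding monomial_span_def monomials_def
    by (rule cspace.span_base) (auto intro!: exI[of _ 1])
  have mult: "x * y \<in> closure monomial_span"
    if xy: "x \<in> closure monomial_span" "y \<in> closure monomial_span" for x y
  proof -
    obtain f g where "\<forall>n. f n \<in> monomial_span" "f \<longlonglongrightarrow> x" "\<forall>n. g n \<in> monomial_span" "g \<longlonglongrightarrow> y"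
      using xy unfolding closure_sequential by blast
    then show ?thesis unfolding closure_sequential
      by (intro exI[of _ "\<lambda>n. f n * g n"]) (auto intro: tendsto_mult monomial_span_mult)
  qed
  have adj: "adj x \<in> closure monomial_span" if x: "x \<in> closure monomial_span" for x
  proof -
    obtain f where "\<forall>n. f n \<in> monomial_span" "f \<longlonglongrightarrow> x"
      using x unfolding closure_sequential by blast
    then show ?thesis unfolding closure_sequential
      by (intro exI[of _ "\<lambda>n. adj (f n)"]) (auto intro: tendsto_adj monomial_span_adj)
  qed
  show ?thesis unfolding unital_cstar_subalgebra_def
    using one closure_subset[of monomial_span] mult adj subspace_closure[OF sub] by blast
qed

lemma edge_in_monomial_span:
  assumes "e \<in> edges d i"
  shows "s e \<in> monomial_span"
proof -
  have "s e = S e * adj (S 1)" using assms by (simp add: S_edge)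
  then show ?thesis unfolding monomial_span_def monomials_def by (intro cspace.span_base) blast
qed

end


section \<open>Averaged compressions\<close>

context kgraph_isometries
begin

text \<open>Averaging over the unitaries of a level replaces \<open>x\<close> by the block-diagonal element all of whose blocks
  are \<open>compress p x\<close>.\<close>

definition compress where
  "compress p x = (1 / card (level p)) *\<^sub>R (\<Sum>l\<in>level p. adj (S l) * x * S l)"

lemma compress_add_right: "compress p (x + y) = compress p x + compress p y"
  by (simp add: compress_def distrib_left distrib_right sum.distrib scaleR_add_right)

lemma compress_scaleC: "compress p (c *\<^sub>C x) = c *\<^sub>C compress p x"
proof -
  have "(\<Sum>l\<in>level p. adj (S l) * (c *\<^sub>C x) * S l) = c *\<^sub>C (\<Sum>l\<in>level p. adj (S l) * x * S l)"
    by (simp add: mult_scaleC_left mult_scaleC_right cspace.scale_sum_right)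
  then show ?thesis unfolding compress_def scaleR_scaleC by (simp only: cspace.scale_left_commute)
qed

lemma compress_zero [simp]: "compress p 0 = 0"
  by (simp add: compress_def)

lemma compress_scaleR: "compress p (r *\<^sub>R x) = r *\<^sub>R compress p x"
  by (simp add: scaleR_scaleC compress_scaleC)

lemma compress_adj: "compress p (adj x) = adj (compress p x)"
  by (simp add: compress_def adj_scaleR adj_sum adj_mult adj_adj mult.assoc)

lemma compress_scalar: "compress p (c *\<^sub>C 1) = c *\<^sub>C 1"
proof -
  have "(\<Sum>l\<in>level p. adj (S l) * 1 * S l) = (\<Sum>l\<in>level p. 1)"
    by (intro sum.cong refl) (simp add: S_isometry)
  then have "(\<Sum>l\<in>level p. adj (S l) * 1 * S l) = real (card (level p)) *\<^sub>R 1"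
    by (simp add: scaleR_conv_of_real)
  then have "compress p 1 = 1"
    unfolding compress_def using card_level_pos[of p] by (simp only: scaleR_scaleR) simp
  then show ?thesis by (simp add: compress_scaleC)
qed

lemma norm_compress_le: "norm (compress p x) \<le> norm x"
proof -
  have "norm (adj (S l) * x * S l) \<le> norm x" for l
    using norm_mult_ineq[of "adj (S l) * x" "S l"] norm_mult_ineq[of "adj (S l)" x] by (simp add: norm_S)
  then have "norm (\<Sum>l\<in>level p. adj (S l) * x * S l) \<le> real (card (level p)) * norm x"
    by (intro sum_norm_bound)
  then show ?thesis using card_level_pos[of p] by (simp add: compress_def field_simps)
qed

lemma bounded_linear_compress: "bounded_linear (compress p)"
  by (rule bounded_linear_intro[where K = 1])
     (auto simp: compress_add_right compress_scaleR norm_compress_le)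

lemma compress_add: "compress (p + q) x = compress q (compress p x)"
proof -
  have "(\<Sum>l\<in>level (p + q). adj (S l) * x * S l)
      = (\<Sum>a\<in>level p. \<Sum>b\<in>level q. adj (S b) * (adj (S a) * x * S a) * S b)"
    unfolding sum_level_add by (simp add: S_mult adj_mult mult.assoc)
  also have "\<dots> = (\<Sum>b\<in>level q. adj (S b) * (\<Sum>a\<in>level p. adj (S a) * x * S a) * S b)"
    by (subst sum.swap) (simp add: sum_distrib_left sum_distrib_right)
  finally show ?thesis
    by (simp add: compress_def card_level_add mult.commute flip: scaleR_sum_right)
qed

lemma compress_commute: "compress p (compress q x) = compress q (compress p x)"
  by (metis compress_add add.commute)

text \<open>Only the summand of \<open>l\<close> itself survives. This asymmetric formula, together with its adjoint below, becomes the
  KMS condition of the limit state.\<close>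

lemma compress_S_left:
  "compress (d l) (S l * y) = (1 / card (level (d l))) *\<^sub>R (y * S l)"
proof -
  have "(\<Sum>m\<in>level (d l). adj (S m) * (S l * y) * S m)
      = (\<Sum>m\<in>level (d l). if m = l then y * S l else 0)"
  proof (intro sum.cong refl)
    fix m assume "m \<in> level (d l)"
    then have "adj (S m) * S l = (if m = l then 1 else 0)"
      by (intro S_orthonormal[of m "d l"]) (auto simp: level_def)
    then show "adj (S m) * (S l * y) * S m = (if m = l then y * S l else 0)"
      by (simp flip: mult.assoc)
  qed
  also have "\<dots> = y * S l" using finite_level by (simp add: level_def)
  finally show ?thesis by (simp add: compress_def)
qed

lemma compress_adj_S_right:
  "compress (d l) (y * adj (S l)) = (1 / card (level (d l))) *\<^sub>R (adj (S l) * y)"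
  using arg_cong[OF compress_S_left[of l "adj y"], of adj]
  by (simp add: adj_mult adj_adj adj_scaleR flip: compress_adj)

text \<open>A sum of squares \<open>adj (x * S l) * (x * S l)\<close> is a single square, because the \<open>S l\<close> are also available as
  isometries with orthogonal ranges that stack the factors \<open>x * S l\<close> into one column.\<close>

lemma compress_square: "\<exists>y. compress p (adj x * x) = adj y * y"
proof -
  define n where "n = real (card (level p))"
  have n: "n > 0" using card_level_pos[of p] by (simp add: n_def)
  define y where "y = (\<Sum>l\<in>level p. S l * x * S l)"
  have "adj y * y = (\<Sum>l\<in>level p. \<Sum>m\<in>level p. adj (S l) * adj x * (adj (S l) * S m) * x * S m)"
    by (simp add: y_def adj_sum adj_mult sum_product mult.assoc)
  also have "\<dots> = (\<Sum>l\<in>level p. \<Sum>m\<in>level p. if l = m then adj (S l) * (adj x * x) * S l else 0)"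
    by (intro sum.cong refl) (simp add: level_orthonormal mult.assoc)
  also have "\<dots> = (\<Sum>l\<in>level p. adj (S l) * (adj x * x) * S l)" by (simp add: finite_level)
  finally have "compress p (adj x * x) = (1 / n) *\<^sub>R (adj y * y)" by (simp add: compress_def n_def)
  also have "\<dots> = adj ((1 / sqrt n) *\<^sub>R y) * ((1 / sqrt n) *\<^sub>R y)"
    using n by (simp add: adj_scaleR)
  finally show ?thesis by blast
qed

lemma compress_iterate:
  "N \<le> p $ i \<Longrightarrow> \<exists>q. \<forall>x. compress p x = compress q ((compress (unit_degree i) ^^ N) x)"
proof (induction N arbitrary: p)
  case 0
  show ?case by auto
next
  case (Suc N)
  then have "p $ i > 0" by simp
  then obtain p' where p': "p = unit_degree i + p'" by (rule degree_split)
  with Suc.prems have "N \<le> p' $ i" by simp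
  then obtain q where "\<forall>x. compress p' x = compress q ((compress (unit_degree i) ^^ N) x)"
    using Suc.IH by blast
  then have "compress p x = compress q ((compress (unit_degree i) ^^ Suc N) x)" for x
    by (simp add: p' compress_add funpow_swap1)
  then show ?case by blast
qed

end


section \<open>Decay under the little pull-back property\<close>

locale pullback_isometries = kgraph_isometries d s
  for d :: "'l::monoid_mult \<Rightarrow> nat ^ 'k::{finite,linorder}" and s :: "'l \<Rightarrow> 'a::cstar_algebra" +
  assumes little_pullback: "little_pullback d"
    and two_edges: "\<And>i. 2 \<le> card (edges d i)"
    and dense: "closure monomial_span = UNIV"
begin

text \<open>In the expansion over the level of degree \<open>d e + d f\<close>, the nonzero terms are indexed by the common extensions of
  \<open>e\<close> and \<open>f\<close> of minimal degree. The little pull-back property leaves at most one, so a product that is in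
  general a sum of partial isometries is a single one.\<close>

lemma adj_edge_mult_edge:
  assumes e: "e \<in> edges d i" and f: "f \<in> edges d j" and "i \<noteq> j"
  shows "adj (S e) * S f = 0 \<or>
    (\<exists>a b. d a = unit_degree j \<and> b \<in> edges d i \<and> adj (S e) * S f = S a * adj (S b))"
proof -
  let ?p = "unit_degree i + unit_degree j"
  define T where "T l = adj (S e) * S l * (adj (S l) * S f)" for l
  have expand: "adj (S e) * S f = (\<Sum>l\<in>level ?p. T l)"
    unfolding T_def by (rule adj_S_mult_S_expand)
  have de: "d e = unit_degree i" and df: "d f = unit_degree j" using e f by (simp_all add: edge_degree)
  have sup: "degree_sup (d e) (d f) = ?p"
    using \<open>i \<noteq> j\<close> by (auto simp: degree_sup_def de df vec_eq_iff)
  have T: "T l = 0 \<or> (\<exists>a b. l = e * a \<and> l = f * b \<and> d a = unit_degree j \<and> b \<in> edges d i \<and>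
      T l = S a * adj (S b))" if l: "l \<in> level ?p" for l
  proof -
    have dl: "d l = unit_degree i + unit_degree j" "d l = unit_degree j + unit_degree i"
      using l by (simp_all add: level_def add.commute)
    obtain e1 a where a: "l = e1 * a" "d e1 = unit_degree i" "d a = unit_degree j"
      using dl(1) by (rule factor_exists)
    obtain f1 b where b: "l = f1 * b" "d f1 = unit_degree j" "d b = unit_degree i"
      using dl(2) by (rule factor_exists)
    have "adj (S e) * S l = (if e1 = e then S a else 0)"
      unfolding a(1) by (rule adj_S_mult_S_prefix) (simp add: a de)
    moreover have "adj (S l) * S f = (if f1 = f then adj (S b) else 0)"
      unfolding b(1) by (rule adj_S_prefix_mult_S) (simp add: b df)
    ultimately have Tl: "T l = (if e1 = e \<and> f1 = f then S a * adj (S b) else 0)" by (simp add: T_def)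
    show ?thesis
    proof (cases "e1 = e \<and> f1 = f")
      case True
      have "b \<in> edges d i" using b(3) by (simp add: edges_iff)
      with True Tl a b show ?thesis by metis
    next
      case False
      with Tl show ?thesis by auto
    qed
  qed
  show ?thesis
  proof (cases "\<forall>l\<in>level ?p. T l = 0")
    case True
    then show ?thesis by (simp add: expand)
  next
    case False
    then obtain l where l: "l \<in> level ?p" "T l \<noteq> 0" by blast
    with T obtain a b where ab: "l = e * a" "l = f * b" "d a = unit_degree j" "b \<in> edges d i"
        "T l = S a * adj (S b)" by blast
    have in_min: "(a', b') \<in> Lambda_min d e f" if "e * a' = f * b'" "d a' = unit_degree j" for a' b'
      unfolding Lambda_min_def sup using that de by (simp add: degree_mult)
    have "finite (Lambda_min d e f)" "card (Lambda_min d e f) \<le> Suc 0"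
      using little_pullback e f \<open>i \<noteq> j\<close> by (auto simp: little_pullback_def)
    then have unique: "x = y" if "x \<in> Lambda_min d e f" "y \<in> Lambda_min d e f" for x y
      using that by (simp add: card_le_Suc0_iff_eq)
    have "T m = 0" if m: "m \<in> level ?p - {l}" for m
    proof (rule ccontr)
      assume "T m \<noteq> 0"
      with T m obtain a' b' where ab': "m = e * a'" "m = f * b'" "d a' = unit_degree j" by blast
      have "(a', b') = (a, b)"
        using ab ab' by (intro unique in_min) auto
      with ab' ab m show False by simp
    qed
    then have "(\<Sum>m\<in>level ?p. T m) = T l"
      using l by (simp add: sum.remove[OF finite_level l(1)])
    then show ?thesis using expand ab by metis
  qed
qed

lemma adj_edge_mult_path:
  assumes "e \<in> edges d i" and "d v $ i = 0"
  shows "adj (S e) * S v = 0 \<or>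
    (\<exists>v' e'. d v' = d v \<and> e' \<in> edges d i \<and> adj (S e) * S v = S v' * adj (S e'))"
  using assms
proof (induction v arbitrary: e rule: edge_induct)
  case one
  then have "adj (S e) * S 1 = S 1 * adj (S e)" by simp
  with one show ?case by metis
next
  case (mult j f v)
  have deg: "d (f * v) = unit_degree j + d v" using mult.hyps by (simp add: degree_mult edge_degree)
  with mult.prems(2) have "i \<noteq> j" and v: "d v $ i = 0" by auto
  have eq: "adj (S e) * S (f * v) = adj (S e) * S f * S v" by (simp add: S_mult mult.assoc)
  from adj_edge_mult_edge[OF mult.prems(1) mult.hyps \<open>i \<noteq> j\<close>] show ?case
  proof (elim disjE exE conjE)
    assume "adj (S e) * S f = 0"
    then show ?thesis by (simp add: eq)
  next
    fix a b assume ab: "d a = unit_degree j" "b \<in> edges d i" "adj (S e) * S f = S a * adj (S b)"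
    from mult.IH[OF ab(2) v] show ?thesis
    proof (elim disjE exE conjE)
      assume "adj (S b) * S v = 0"
      then show ?thesis by (simp add: eq ab(3) mult.assoc)
    next
      fix v' e' assume v': "d v' = d v" "e' \<in> edges d i" "adj (S b) * S v = S v' * adj (S e')"
      have "d (a * v') = d (f * v)" by (simp only: deg degree_mult[of a] ab(1) v'(1))
      moreover have "adj (S e) * S (f * v) = S (a * v') * adj (S e')"
        unfolding eq ab(3) by (simp add: v'(3) S_mult mult.assoc)
      ultimately show ?thesis using v'(2) by blast
    qed
  qed
qed

text \<open>Removing the first edge \<open>e\<close> of \<open>u\<close> by compression moves it to the other side, where it meets \<open>adj (S v)\<close>. If \<open>v\<close>
  has colour \<open>i\<close> as well, both lose an edge or the product vanishes. If not, the edge passes through \<open>v\<close> and returns at the end of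
  \<open>u\<close>. In each case a nonzero result is again a monomial of unequal \<open>i\<close>-degrees, divided by the
  number of edges of colour \<open>i\<close>.\<close>

lemma compress_monomial_left:
  assumes "d u $ i \<noteq> d v $ i" "d u $ i > 0"
  shows "compress (unit_degree i) (S u * adj (S v)) = 0 \<or>
    (\<exists>u' v'. d u' $ i \<noteq> d v' $ i \<and>
      compress (unit_degree i) (S u * adj (S v)) = (1 / card (edges d i)) *\<^sub>R (S u' * adj (S v')))"
proof -
  obtain e u1 where u: "u = e * u1" "e \<in> edges d i" "d u = unit_degree i + d u1"
    using assms(2) by (rule factor_edge)
  have "compress (unit_degree i) (S u * adj (S v))
      = (1 / card (edges d i)) *\<^sub>R (S u1 * (adj (S v) * S e))"
    using compress_S_left[of e "S u1 * adj (S v)"] u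
    by (simp add: edge_degree edges_eq_level S_mult mult.assoc)
  then have eq: "compress (unit_degree i) (S u * adj (S v))
      = (1 / card (edges d i)) *\<^sub>R (S u1 * adj (adj (S e) * S v))"
    by (simp add: adj_mult adj_adj)
  show ?thesis
  proof (cases "d v $ i > 0")
    case True
    then obtain f v1 where v: "v = f * v1" "f \<in> edges d i" "d v = unit_degree i + d v1"
      by (rule factor_edge)
    have "adj (S e) * S v = (if f = e then S v1 else 0)"
      unfolding v(1) using u v by (intro adj_S_mult_S_prefix) (simp add: edge_degree)
    moreover have "d u1 $ i \<noteq> d v1 $ i" using assms(1) by (simp add: u(3) v(3))
    ultimately show ?thesis using eq by (cases "f = e") auto
  next
    case False
    then have "d v $ i = 0" by simp
    from adj_edge_mult_path[OF u(2) this] show ?thesis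
    proof (elim disjE exE conjE)
      assume "adj (S e) * S v = 0"
      then show ?thesis by (simp add: eq)
    next
      fix v' e' assume v': "d v' = d v" "e' \<in> edges d i" "adj (S e) * S v = S v' * adj (S e')"
      have "S u1 * adj (adj (S e) * S v) = S (u1 * e') * adj (S v')"
        by (simp add: v'(3) adj_mult adj_adj S_mult mult.assoc)
      moreover have "d (u1 * e') = d u" using v'(2) by (simp add: degree_mult edge_degree u(3) add.commute)
      ultimately show ?thesis using eq v'(1) assms(1) by metis
    qed
  qed
qed

lemma compress_monomial:
  assumes "d u $ i \<noteq> d v $ i"
  shows "compress (unit_degree i) (S u * adj (S v)) = 0 \<or>
    (\<exists>u' v'. d u' $ i \<noteq> d v' $ i \<and>
      compress (unit_degree i) (S u * adj (S v)) = (1 / card (edges d i)) *\<^sub>R (S u' * adj (S v')))"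
proof (cases "d u $ i > 0")
  case True
  with compress_monomial_left[OF assms] show ?thesis by blast
next
  case False
  have flip: "compress (unit_degree i) (S u * adj (S v)) = adj (compress (unit_degree i) (S v * adj (S u)))"
    by (simp add: adj_mult adj_adj flip: compress_adj)
  have "d v $ i \<noteq> d u $ i" "d v $ i > 0" using assms False by auto
  from compress_monomial_left[OF this] show ?thesis
  proof (elim disjE exE conjE)
    assume "compress (unit_degree i) (S v * adj (S u)) = 0"
    then show ?thesis unfolding flip by simp
  next
    fix u' v' assume uv': "d u' $ i \<noteq> d v' $ i"
      "compress (unit_degree i) (S v * adj (S u)) = (1 / card (edges d i)) *\<^sub>R (S u' * adj (S v'))"
    then have "compress (unit_degree i) (S u * adj (S v)) = (1 / card (edges d i)) *\<^sub>R (S v' * adj (S u'))"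
      unfolding flip by (simp add: adj_scaleR adj_mult adj_adj)
    with uv'(1) show ?thesis by metis
  qed
qed

lemma norm_iterated_compress_le:
  "d u $ i \<noteq> d v $ i \<Longrightarrow> norm ((compress (unit_degree i) ^^ N) (S u * adj (S v))) \<le> (1/2) ^ N"
proof (induction N arbitrary: u v)
  case 0
  show ?case using norm_mult_ineq[of "S u" "adj (S v)"] by (simp add: norm_S)
next
  case (Suc N)
  let ?L = "compress (unit_degree i)"
  have zero: "(?L ^^ n) 0 = 0" for n by (induction n) auto
  have scale: "(?L ^^ n) (r *\<^sub>R x) = r *\<^sub>R (?L ^^ n) x" for n r x
    by (induction n) (auto simp: compress_scaleR)
  have step: "(?L ^^ Suc N) x = (?L ^^ N) (?L x)" for x by (simp only: funpow_Suc_right o_apply)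
  from compress_monomial[OF Suc.prems] show ?case
  proof (elim disjE exE conjE)
    assume "?L (S u * adj (S v)) = 0"
    then show ?thesis unfolding step by (simp add: zero)
  next
    fix u' v' assume uv': "d u' $ i \<noteq> d v' $ i"
      "?L (S u * adj (S v)) = (1 / card (edges d i)) *\<^sub>R (S u' * adj (S v'))"
    have "1 / real (card (edges d i)) \<le> 1/2" using two_edges[of i] by (simp add: field_simps)
    then have "1 / real (card (edges d i)) * norm ((?L ^^ N) (S u' * adj (S v'))) \<le> 1/2 * (1/2) ^ N"
      using Suc.IH[OF uv'(1)] by (intro mult_mono) auto
    then show ?thesis unfolding step uv'(2) scale by simp
  qed
qed

definition compresses_to where
  "compresses_to x c \<longleftrightarrow> (\<lambda>N. compress (vec N) x) \<longlonglongrightarrow> c *\<^sub>C 1"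

text \<open>A monomial whose degrees differ in colour \<open>i\<close> decays geometrically, as \<open>vec N\<close> contains \<open>N\<close> compressions of colour
  \<open>i\<close>. A balanced monomial becomes a scalar after the compression of degree \<open>d u\<close>, and scalars are fixed.\<close>

lemma monomial_compresses: "\<exists>c. compresses_to (S u * adj (S v)) c"
proof (cases "d u = d v")
  case False
  then obtain i where i: "d u $ i \<noteq> d v $ i" by (auto simp: vec_eq_iff)
  have "norm (compress (vec N) (S u * adj (S v))) \<le> (1/2) ^ N" for N
  proof -
    have "N \<le> vec N $ i" by simp
    from compress_iterate[OF this] obtain q
      where q: "\<forall>x. compress (vec N) x = compress q ((compress (unit_degree i) ^^ N) x)" ..
    have "norm (compress (vec N) (S u * adj (S v)))
        \<le> norm ((compress (unit_degree i) ^^ N) (S u * adj (S v)))"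
      unfolding q[rule_format] by (rule norm_compress_le)
    also have "\<dots> \<le> (1/2) ^ N" by (rule norm_iterated_compress_le[OF i])
    finally show ?thesis .
  qed
  then have "\<forall>\<^sub>F N in sequentially. norm (compress (vec N) (S u * adj (S v))) \<le> (1/2) ^ N"
    by (simp add: always_eventually)
  moreover have "(\<lambda>N. (1/2 :: real) ^ N) \<longlonglongrightarrow> 0" by (rule LIMSEQ_power_zero) simp
  ultimately have "(\<lambda>N. compress (vec N) (S u * adj (S v))) \<longlonglongrightarrow> 0"
    by (rule Lim_null_comparison)
  then have "compresses_to (S u * adj (S v)) 0" by (simp add: compresses_to_def)
  then show ?thesis ..
next
  case True
  define c where "c = (if u = v then complex_of_real (1 / card (level (d u))) else 0)"
  have cu: "compress (d u) (S u * adj (S v)) = c *\<^sub>C 1"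
    unfolding compress_S_left S_orthonormal[OF True[symmetric] refl]
    by (cases "u = v") (simp_all add: c_def scaleR_scaleC)
  have ev: "\<forall>\<^sub>F N in sequentially. compress (vec N) (S u * adj (S v)) = c *\<^sub>C 1"
    unfolding eventually_sequentially
  proof (intro exI allI impI)
    fix N assume N: "(\<Sum>i\<in>UNIV. d u $ i) \<le> N"
    have le: "d u $ i \<le> N" for i
      using order_trans[OF member_le_sum[of i UNIV "\<lambda>i. d u $ i"] N] by simp
    define q where "q = (\<chi> i. N - d u $ i)"
    have q: "vec N = d u + q" unfolding vec_eq_iff q_def by (simp add: le)
    have "compress (vec N) (S u * adj (S v)) = compress q (c *\<^sub>C 1)"
      unfolding q compress_add cu ..
    then show "compress (vec N) (S u * adj (S v)) = c *\<^sub>C 1" unfolding compress_scalar .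
  qed
  then have "compresses_to (S u * adj (S v)) c"
    unfolding compresses_to_def by (rule tendsto_eventually)
  then show ?thesis ..
qed

lemma compresses_to_lincomb:
  "compresses_to x a \<Longrightarrow> compresses_to y b \<Longrightarrow> compresses_to (c *\<^sub>C x + y) (c * a + b)"
  unfolding compresses_to_def compress_add_right compress_scaleC scaleC_add_left scaleC_scaleC[symmetric]
  by (intro tendsto_intros)

lemma compresses_to_unique: "compresses_to x a \<Longrightarrow> compresses_to x b \<Longrightarrow> a = b"
  unfolding compresses_to_def by (metis LIMSEQ_unique scalar_eq_iff)

lemma norm_compresses_to_le:
  assumes "compresses_to x c"
  shows "cmod c \<le> norm x"
proof -
  have "norm (c *\<^sub>C (1::'a)) \<le> norm x"
    using assms unfolding compresses_to_def
    by (rule Lim_norm_ubound[rotated]) (simp_all add: norm_compress_le)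
  then show ?thesis by (simp add: norm_scaleC)
qed

lemma compresses_to_minus:
  assumes "compresses_to x a" "compresses_to y b"
  shows "compresses_to (x - y) (a - b)"
proof -
  have "compresses_to ((-1) *\<^sub>C y + x) ((-1) * b + a)" by (intro compresses_to_lincomb assms)
  then show ?thesis by simp
qed

text \<open>Compressions are contractive, so the limits on the span of the monomials pass to its closure.\<close>

lemma compresses_to_exists: "\<exists>c. compresses_to x c"
proof -
  have span: "\<exists>c. compresses_to y c" if "y \<in> monomial_span" for y
    using that unfolding monomial_span_def
  proof (induction rule: cspace.span_induct_alt)
    case base
    have "compresses_to 0 0" by (simp add: compresses_to_def)
    then show ?case ..
  next
    case (step c z y)
    obtain u v where "z = S u * adj (S v)" using step(1) unfolding monomials_def by blast
    with monomial_compresses obtain a where "compresses_to z a" by blast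
    moreover obtain b where "compresses_to y b" using step(2) by blast
    ultimately show ?case by (blast intro: compresses_to_lincomb)
  qed
  have "x \<in> closure monomial_span" by (simp add: dense)
  then obtain f where f: "\<And>n. f n \<in> monomial_span" and fx: "f \<longlonglongrightarrow> x"
    unfolding closure_sequential by blast
  obtain c where c: "\<And>n. compresses_to (f n) (c n)" using span[OF f] by metis
  have "Cauchy c"
  proof (rule metric_CauchyI)
    fix e :: real assume "e > 0"
    then obtain M where M: "\<forall>m\<ge>M. \<forall>n\<ge>M. dist (f m) (f n) < e"
      using LIMSEQ_imp_Cauchy[OF fx] unfolding Cauchy_def by blast
    have "dist (c m) (c n) \<le> dist (f m) (f n)" for m n
      unfolding dist_norm by (intro norm_compresses_to_le compresses_to_minus c)
    with M show "\<exists>M. \<forall>m\<ge>M. \<forall>n\<ge>M. dist (c m) (c n) < e"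
      using le_less_trans by blast
  qed
  then obtain l where l: "c \<longlonglongrightarrow> l" using Cauchy_convergent convergentD by blast
  have "compresses_to x l" unfolding compresses_to_def
  proof (rule metric_LIMSEQ_I)
    fix e :: real assume "e > 0"
    then have e3: "e / 3 > 0" by simp
    obtain n where n: "dist (f n) x < e / 3" "dist (c n) l < e / 3"
    proof -
      have "\<forall>\<^sub>F n in sequentially. dist (f n) x < e / 3 \<and> dist (c n) l < e / 3"
        using tendstoD[OF fx e3] tendstoD[OF l e3] by (rule eventually_conj)
      then show thesis using that eventually_happens by fastforce
    qed
    obtain M where M: "\<forall>N\<ge>M. dist (compress (vec N) (f n)) (c n *\<^sub>C 1) < e / 3"
      using c[of n] e3 unfolding compresses_to_def LIMSEQ_def by blast
    have "dist (compress (vec N) x) (l *\<^sub>C 1) < e" if "N \<ge> M" for N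
    proof -
      have "dist (compress (vec N) x) (compress (vec N) (f n)) \<le> dist (f n) x"
        unfolding dist_norm
        using norm_compress_le[of "vec N" "x - f n"]
        by (simp add: linear_diff[OF bounded_linear.linear[OF bounded_linear_compress]] norm_minus_commute)
      moreover have "dist (c n *\<^sub>C (1::'a)) (l *\<^sub>C 1) = dist (c n) l"
        by (simp add: dist_norm norm_scaleC flip: cspace.scale_left_diff_distrib)
      moreover have "dist (compress (vec N) (f n)) (c n *\<^sub>C 1) < e / 3" using M that by blast
      ultimately show ?thesis
        using n dist_triangle[of "compress (vec N) x" "l *\<^sub>C 1" "compress (vec N) (f n)"]
          dist_triangle[of "compress (vec N) (f n)" "l *\<^sub>C 1" "c n *\<^sub>C 1"] by linarith
    qed
    then show "\<exists>M. \<forall>N\<ge>M. dist (compress (vec N) x) (l *\<^sub>C 1) < e" by blast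
  qed
  then show ?thesis ..
qed


section \<open>The canonical state\<close>

definition state :: "'a \<Rightarrow> complex" where
  "state x = (THE c. compresses_to x c)"

lemma compresses_to_iff: "compresses_to x c \<longleftrightarrow> state x = c"
  unfolding state_def using compresses_to_exists compresses_to_unique by (metis theI)

lemma compress_tendsto_state: "(\<lambda>N. compress (vec N) x) \<longlonglongrightarrow> state x *\<^sub>C 1"
  using compresses_to_iff[of x "state x"] by (simp add: compresses_to_def)

lemma state_lincomb: "state (c *\<^sub>C x + y) = c * state x + state y"
  using compresses_to_lincomb by (simp add: compresses_to_iff)

lemma state_zero [simp]: "state 0 = 0"
  using state_lincomb[of 1 0 0] by simp

lemma state_add: "state (x + y) = state x + state y"
  using state_lincomb[of 1 x y] by simp

lemma state_scaleC: "state (c *\<^sub>C x) = c * state x"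
  using state_lincomb[of c x 0] by simp

lemma bounded_linear_state: "bounded_linear state"
  by (rule bounded_linear_intro[where K = 1])
     (auto simp: state_add scaleR_scaleC state_scaleC scaleR_conv_of_real
        intro: norm_compresses_to_le simp: compresses_to_iff)

lemma state_one: "state 1 = 1"
  using compress_scalar[of _ 1] by (simp add: compresses_to_def flip: compresses_to_iff)

lemma state_adj: "state (adj x) = cnj (state x)"
proof -
  have "(\<lambda>N. compress (vec N) (adj x)) \<longlonglongrightarrow> adj (state x *\<^sub>C 1)"
    unfolding compress_adj by (intro tendsto_intros compress_tendsto_state)
  then show ?thesis by (simp add: adj_scaleC compresses_to_def flip: compresses_to_iff)
qed

lemma state_compress: "state (compress p x) = state x"
proof -
  have "(\<lambda>N. compress p (compress (vec N) x)) \<longlonglongrightarrow> compress p (state x *\<^sub>C 1)"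
    by (intro bounded_linear.tendsto[OF bounded_linear_compress] compress_tendsto_state)
  then have "compresses_to (compress p x) (state x)"
    by (simp add: compresses_to_def compress_commute[of p] compress_scalar)
  then show ?thesis by (simp add: compresses_to_iff)
qed

text \<open>The KMS condition: moving a generator from one end of the argument to the other multiplies the state
  by a nonzero factor, so that vanishing is preserved.\<close>

lemma state_S_left: "state (S l * y) = state (y * S l) / card (level (d l))"
  using state_compress[of "d l" "S l * y"]
  by (simp add: compress_S_left scaleR_scaleC state_scaleC)

lemma state_adj_S_right: "state (y * adj (S l)) = state (adj (S l) * y) / card (level (d l))"
  using state_compress[of "d l" "y * adj (S l)"]
  by (simp add: compress_adj_S_right scaleR_scaleC state_scaleC)

lemma state_square: "Im (state (adj x * x)) = 0" "0 \<le> Re (state (adj x * x))"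
proof -
  have "\<forall>N. \<exists>y. compress (vec N) (adj x * x) = adj y * y" by (intro allI compress_square)
  then obtain y where y: "\<forall>N. compress (vec N) (adj x * x) = adj (y N) * y N"
    by (rule choice[THEN exE])
  have "(\<lambda>N. adj (y N) * y N) \<longlonglongrightarrow> state (adj x * x) *\<^sub>C 1"
    using compress_tendsto_state[of "adj x * x"] by (simp add: y)
  from scalar_limit_of_squares_nonneg[OF this]
  show "Im (state (adj x * x)) = 0" "0 \<le> Re (state (adj x * x))" by simp_all
qed

text \<open>The Cauchy-Schwarz inequality in the degenerate case: the state is nonnegative on the squares of
  \<open>x + t * adj y\<close> for every scalar \<open>t\<close>, and the term linear in \<open>t\<close> dominates for small \<open>t\<close>.\<close>

lemma state_null_left:
  assumes null: "state (adj x * x) = 0"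
  shows "state (y * x) = 0"
proof (rule ccontr)
  define b where "b = state (y * x)"
  define M where "M = Re (state (y * adj y))"
  assume "state (y * x) \<noteq> 0"
  then have b: "cmod b > 0" by (simp add: b_def)
  have M: "state (y * adj y) = of_real M"
    using state_square(1)[of "adj y"] by (simp add: M_def adj_adj complex_eq_iff)
  have M0: "M \<ge> 0" using state_square(2)[of "adj y"] by (simp add: M_def adj_adj)
  have bad: "2 * r \<le> r\<^sup>2 * M" if "r > 0" for r :: real
  proof -
    \<comment> \<open>The phase of \<open>t\<close> makes the linear term negative.\<close>
    define t where "t = - (of_real r * b)"
    have "adj (x + t *\<^sub>C adj y) * (x + t *\<^sub>C adj y)
        = cnj t *\<^sub>C (y * x) + (t *\<^sub>C adj (y * x) + ((cnj t * t) *\<^sub>C (y * adj y) + adj x * x))"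
      by (simp add: adj_add adj_scaleC adj_adj adj_mult algebra_simps mult_scaleC_left
          mult_scaleC_right scaleC_scaleC)
    then have "state (adj (x + t *\<^sub>C adj y) * (x + t *\<^sub>C adj y))
        = cnj t * b + t * cnj b + cnj t * t * of_real M"
      by (simp only: state_lincomb state_adj null M b_def) simp
    also have "\<dots> = of_real ((cmod b)\<^sup>2 * (r\<^sup>2 * M - 2 * r))"
    proof -
      have k: "b * cnj b = of_real ((cmod b)\<^sup>2)" by (simp only: complex_norm_square)
      have "cnj t * b + t * cnj b + cnj t * t * of_real M
          = (b * cnj b) * (of_real r * of_real r * of_real M - 2 * of_real r)"
        by (simp add: t_def algebra_simps)
      then show ?thesis unfolding k by (simp add: power2_eq_square)
    qed
    finally have "0 \<le> (cmod b)\<^sup>2 * (r\<^sup>2 * M - 2 * r)"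
      using state_square(2)[of "x + t *\<^sub>C adj y"] by (simp only: Re_complex_of_real)
    with b show ?thesis by (simp add: zero_le_mult_iff)
  qed
  define k where "k = M + 1"
  have k: "k > 0" using M0 by (simp add: k_def)
  have "2 * (1 / k) \<le> (1 / k)\<^sup>2 * M" using k by (intro bad) simp
  from mult_right_mono[OF this, of "k\<^sup>2"] have "2 * k \<le> M"
    using k by (simp add: power2_eq_square)
  with M0 show False by (simp add: k_def)
qed

text \<open>By the KMS condition a monomial on the right of \<open>x\<close> can be moved to the left, where Cauchy-Schwarz
  applies.\<close>

lemma state_null_ideal:
  assumes null: "state (adj x * x) = 0"
  shows "state (y * x * z) = 0"
proof -
  have mono: "state (y * x * w) = 0" if "w \<in> monomials" for w
  proof -
    obtain u v where w: "w = S u * adj (S v)" using \<open>w \<in> monomials\<close> by (auto simp: monomials_def)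
    have "state (S u * (adj (S v) * y * x)) = state (adj (S v) * y * x * S u) / card (level (d u))"
      by (rule state_S_left)
    moreover have "state (S u * (adj (S v) * y * x)) = 0"
      using state_null_left[OF null, of "S u * adj (S v) * y"] by (simp add: mult.assoc)
    ultimately have "state (adj (S v) * y * x * S u) = 0" using card_level_pos[of "d u"] by simp
    then show ?thesis
      using state_adj_S_right[of "y * x * S u" v] by (simp add: w mult.assoc)
  qed
  have span: "state (y * x * w) = 0" if "w \<in> monomial_span" for w
    using that unfolding monomial_span_def
  proof (induction rule: cspace.span_induct_alt)
    case (step c w w')
    then show ?case by (simp add: distrib_left mult_scaleC_right state_lincomb mono)
  qed simp
  have "closed {w. state (y * x * w) = 0}"
    by (intro closed_Collect_eq continuous_intros
        bounded_linear.continuous_on[OF bounded_linear_state])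
  then have "closure monomial_span \<subseteq> {w. state (y * x * w) = 0}"
    using span by (intro closure_minimal) auto
  then show ?thesis by (auto simp: dense)
qed

text \<open>The elements annihilated by the state together with all their two-sided multiples form a closed ideal that does not
  contain 1. It is zero by simplicity, and the previous lemma puts \<open>x\<close> in it.\<close>

lemma state_faithful:
  assumes simple: "simple_cstar (UNIV :: 'a set)" and null: "state (adj x * x) = 0"
  shows "x = 0"
proof -
  define J where "J = {x. \<forall>y z. state (y * x * z) = 0}"
  have "closed J" unfolding J_def
    by (intro closed_Collect_all closed_Collect_eq continuous_intros
        bounded_linear.continuous_on[OF bounded_linear_state])
  moreover have "cspace.subspace J"
    by (rule cspace.subspaceI)
       (auto simp: J_def distrib_left distrib_right state_add mult_scaleC_left mult_scaleC_right state_scaleC)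
  moreover have "a * x \<in> J \<and> x * a \<in> J" if "x \<in> J" for a x
  proof -
    have J: "state (y * x * z) = 0" for y z using that by (simp add: J_def)
    show ?thesis using J[of "y * a" z for y z] J[of y "a * z" for y z] by (simp add: J_def mult.assoc)
  qed
  ultimately have "closed_ideal UNIV J" by (simp add: closed_ideal_def)
  moreover have "1 \<notin> J"
  proof
    assume "1 \<in> J"
    then have "state (1 * 1 * 1) = 0" unfolding J_def by blast
    then show False by (simp add: state_one)
  qed
  ultimately have "J = {0}" using simple unfolding simple_cstar_def by blast
  moreover have "x \<in> J" using state_null_ideal[OF null] by (simp add: J_def)
  ultimately show ?thesis by simp
qed

end


section \<open>A coordinate with a single edge\<close>

context kgraph_isometries
begin

text \<open>If \<open>e\<close> is the only edge of its colour, then \<open>e * l\<close> can be factored with \<open>e\<close> at the end, so that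
  \<open>e * l = \<pi> l * e\<close> for a degree-preserving injection \<open>\<pi>\<close>. It permutes the finite set of all edges, and a power of it fixes
  every edge.\<close>

lemma single_edge_power_commutes:
  assumes single: "edges d i = {e}"
  shows "\<exists>N>0. \<forall>j. \<forall>f\<in>edges d j. s e ^ N * s f = s f * s e ^ N"
proof -
  have "e \<in> edges d i" by (simp add: single)
  then have de: "d e = unit_degree i" by (simp add: edges_iff)
  have "\<forall>l. \<exists>l'. e * l = l' * e \<and> d l' = d l"
  proof
    fix l
    have "d (e * l) = d l + unit_degree i" by (simp add: degree_mult de add.commute)
    then obtain l' e' where l': "e * l = l' * e'" "d l' = d l" "d e' = unit_degree i"
      by (rule factor_exists)
    then have "e' \<in> edges d i" by (simp add: edges_iff)
    then have "e' = e" by (simp add: single)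
    with l' show "\<exists>l'. e * l = l' * e \<and> d l' = d l" by blast
  qed
  then obtain \<pi> where "\<forall>l. e * l = \<pi> l * e \<and> d (\<pi> l) = d l" by (rule choice[THEN exE])
  then have \<pi>: "e * l = \<pi> l * e" "d (\<pi> l) = d l" for l by simp_all
  have inj: "inj \<pi>"
  proof (rule injI)
    fix l l' assume "\<pi> l = \<pi> l'"
    then have "e * l = e * l'" by (simp add: \<pi>(1))
    then show "l = l'" using factor_unique by blast
  qed
  define F where "F = all_edges"
  have finF: "finite F" using finite_edges by (simp add: F_def)
  have d_iter: "d ((\<pi> ^^ n) l) = d l" for n l by (induction n) (simp_all add: \<pi>(2))
  have iter_F: "(\<pi> ^^ n) f \<in> F" if "f \<in> F" for n f
    using that by (auto simp: F_def edges_iff d_iter)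
  \<comment> \<open>Two iterates agree on the finitely many edges, and injectivity cancels the smaller exponent.\<close>
  have "\<not> inj (\<lambda>n. restrict (\<pi> ^^ n) F)"
  proof
    assume "inj (\<lambda>n. restrict (\<pi> ^^ n) F)"
    moreover have "range (\<lambda>n. restrict (\<pi> ^^ n) F) \<subseteq> (F \<rightarrow>\<^sub>E F)" using iter_F by auto
    ultimately have "finite (UNIV :: nat set)"
      using finite_PiE[OF finF, of "\<lambda>_. F"] finF inj_on_finite by blast
    then show False by simp
  qed
  then obtain a b where ab: "a < b" "restrict (\<pi> ^^ a) F = restrict (\<pi> ^^ b) F"
    unfolding inj_def by (metis linorder_neqE_nat)
  define N where "N = b - a"
  have N: "N > 0" "b = a + N" using ab(1) by (simp_all add: N_def)
  have fixed: "(\<pi> ^^ N) f = f" if "f \<in> F" for f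
  proof -
    have "(\<pi> ^^ a) ((\<pi> ^^ N) f) = (\<pi> ^^ b) f" by (simp add: N(2) funpow_add)
    also have "\<dots> = (\<pi> ^^ a) f" using ab(2) that by (metis restrict_apply')
    finally show ?thesis using inj_fn[OF inj, of a] by (simp add: inj_eq)
  qed
  have push: "e ^ n * l = (\<pi> ^^ n) l * e ^ n" for n l
  proof (induction n)
    case (Suc n)
    have "e ^ Suc n * l = e * ((\<pi> ^^ n) l * e ^ n)" by (simp add: Suc mult.assoc)
    also have "\<dots> = \<pi> ((\<pi> ^^ n) l) * e * e ^ n" by (simp add: \<pi>(1) flip: mult.assoc)
    finally show ?case by (simp add: mult.assoc)
  qed simp
  have S_power: "S (e ^ n) = s e ^ n" for n
    using S_edge[of e i] single by (induction n) (simp_all add: S_mult)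
  have "s e ^ N * s f = s f * s e ^ N" if f: "f \<in> edges d j" for j f
  proof -
    have "f \<in> F" using f by (auto simp: F_def)
    then have "e ^ N * f = f * e ^ N" using push[of N f] fixed by simp
    then have "S (e ^ N) * S f = S f * S (e ^ N)" by (simp flip: S_mult)
    then show ?thesis using f by (simp add: S_power S_edge)
  qed
  with N(1) show ?thesis by blast
qed

end


section \<open>The universal algebra\<close>

lemma finsum_whole: "finite F \<Longrightarrow> finsum whole f F = (\<Sum>x\<in>F. f x :: 'a::cstar_algebra)"
proof (induction F rule: finite_induct)
  interpret cstar_algebra_on "whole :: 'a cstar" by (rule cstar_algebra_on_whole)
  case empty
  have "finsum whole f {} = \<zero>\<^bsub>whole\<^esub>" by (rule finsum_empty)
  then show ?case by (simp add: whole_def)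
next
  interpret cstar_algebra_on "whole :: 'a cstar" by (rule cstar_algebra_on_whole)
  case (insert x F)
  then have "finsum whole f (insert x F) = f x \<oplus>\<^bsub>whole\<^esub> finsum whole f F"
    by (intro finsum_insert) (auto simp: whole_def)
  with insert show ?case by (simp add: whole_def)
qed

lemma cuntz_type_whole_iff:
  assumes "finite F"
  shows "cuntz_type whole F V \<longleftrightarrow>
    (\<forall>e\<in>F. \<forall>f\<in>F. adj (V e) * V f = (if e = f then 1 else (0 :: 'a::cstar_algebra))) \<and>
    (\<Sum>e\<in>F. V e * adj (V e)) = 1"
  unfolding cuntz_type_def finsum_whole[OF assms] by (simp add: whole_def)

lemma cuntz_representation_kgraph_isometries:
  assumes "single_vertex_kgraph d" and "cuntz_representation d whole s"
  shows "kgraph_isometries d s"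
proof -
  interpret single_vertex_kgraph d by fact
  have ct: "cuntz_type whole (edges d i) s" for i
    using assms(2) by (simp add: cuntz_representation_def)
  have rel: "s e * s f = s f' * s e'"
    if "i < j" "e \<in> edges d i" "f \<in> edges d j" "e' \<in> edges d i" "f' \<in> edges d j" "e * f = f' * e'"
    for i j e f e' f'
    using assms(2) that by (simp add: cuntz_representation_def whole_def)
  show ?thesis
  proof unfold_locales
    show "adj (s e) * s f = (if e = f then 1 else 0)" if "e \<in> edges d i" "f \<in> edges d i" for i e f
      using ct[of i] that by (simp add: cuntz_type_whole_iff finite_edges)
    show "(\<Sum>e\<in>edges d i. s e * adj (s e)) = 1" for i
      using ct[of i] by (simp add: cuntz_type_whole_iff finite_edges)
    show "s e * s f = s f' * s e'"
      if "i \<noteq> j" "e \<in> edges d i" "f \<in> edges d j" "e' \<in> edges d i" "f' \<in> edges d j" "e * f = f' * e'"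
      for i j e f e' f'
    proof (cases "i < j")
      case True
      with that rel show ?thesis by blast
    next
      case False
      with that(1) have "j < i" by simp
      from rel[OF this that(5,4,3,2) that(6)[symmetric]] show ?thesis by simp
    qed
  qed
qed

lemma O_theta_generated:
  assumes "is_O_theta d s" and "unital_cstar_subalgebra C" and "\<And>i e. e \<in> edges d i \<Longrightarrow> s e \<in> C"
  shows "C = UNIV"
proof -
  have "\<forall>i. s ` edges d i \<subseteq> C" using assms(3) by blast
  with assms(1,2) show ?thesis unfolding is_O_theta_def by blast
qed

text \<open>The tuples multiplied by a scalar of modulus 1 still form a Cuntz-type representation, so universality
  provides the gauge homomorphism.\<close>

lemma O_theta_gauge:
  fixes d :: "'l::monoid_mult \<Rightarrow> nat ^ 'k::{finite,linorder}" and s :: "'l \<Rightarrow> 'a::cstar_algebra"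
  assumes "single_vertex_kgraph d" and O: "is_O_theta d s" and z: "cmod z = 1"
  obtains h where "unital_star_hom h (whole :: 'a cstar)"
    "\<And>i e. e \<in> edges d i \<Longrightarrow> h (s e) = z *\<^sub>C s e"
proof -
  interpret kgraph_isometries d s
    using assms(1) O by (intro cuntz_representation_kgraph_isometries) (simp_all add: is_O_theta_def)
  have zz: "cnj z * z = 1" "z * cnj z = 1"
    using z complex_norm_square[of z] by (simp_all add: mult.commute)
  let ?E = "\<lambda>l. z *\<^sub>C s l"
  have "cuntz_type whole (edges d i) ?E" for i
    unfolding cuntz_type_whole_iff[OF finite_edges]
    using edge_orthonormal[of _ i] edge_complete[of i] zz
    by (simp add: adj_scaleC mult_scaleC_left mult_scaleC_right scaleC_scaleC)
  moreover have "?E e * ?E f = ?E f' * ?E e'"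
    if "i < j" "e \<in> edges d i" "f \<in> edges d j" "e' \<in> edges d i" "f' \<in> edges d j" "e * f = f' * e'"
    for i j e f e' f'
    using edge_relation[OF less_imp_neq[OF that(1)] that(2-6)]
    by (simp add: mult_scaleC_left mult_scaleC_right)
  ultimately have "cuntz_representation d whole ?E"
    unfolding cuntz_representation_def by (simp add: whole_def)
  moreover have "\<exists>h. unital_star_hom h B \<and> (\<forall>i. \<forall>e\<in>edges d i. h (s e) = E e)"
    if "cstar_algebra_on B \<and> cuntz_representation d B E" for B :: "'a cstar" and E
    using O that unfolding is_O_theta_def by blast
  ultimately obtain h where "unital_star_hom h (whole :: 'a cstar)" "\<forall>i. \<forall>e\<in>edges d i. h (s e) = ?E e"
    using cstar_algebra_on_whole by blast
  then show thesis by (intro that[of h]) auto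
qed

lemma commutant_of_unitary_subalgebra:
  assumes W: "adj W * W = 1" "W * adj W = (1 :: 'a::cstar_algebra)"
  shows "unital_cstar_subalgebra {x. W * x = x * W}"
proof -
  have "W * adj x = adj x * W" if "W * x = x * W" for x
  proof -
    have "adj x * adj W = adj W * adj x" using arg_cong[OF that, of adj] by (simp add: adj_mult)
    then have "W * (adj x * adj W) * W = W * (adj W * adj x) * W" by simp
    then have "W * adj x * (adj W * W) = (W * adj W) * adj x * W" by (simp only: mult.assoc)
    with W show ?thesis by simp
  qed
  moreover have "W * (x * y) = x * y * W" if "W * x = x * W" "W * y = y * W" for x y
  proof -
    have "W * (x * y) = (x * W) * y" using that(1) by (simp flip: mult.assoc)
    also have "\<dots> = x * (y * W)" using that(2) by (simp add: mult.assoc)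
    finally show ?thesis by (simp add: mult.assoc)
  qed
  moreover have "closed {x. W * x = x * W}" by (intro closed_Collect_eq continuous_intros)
  moreover have "cspace.subspace {x. W * x = x * W}"
    by (rule cspace.subspaceI)
       (auto simp: distrib_left distrib_right mult_scaleC_left mult_scaleC_right)
  ultimately show ?thesis by (simp add: unital_cstar_subalgebra_def)
qed

text \<open>A single edge of a colour is mapped to a unitary, and a power \<open>W\<close> of that unitary commutes with all
  generators. In a simple algebra it is scalar, hence fixed by every unital homomorphism, but a gauge homomorphism maps it to
  \<open>- W\<close>.\<close>

lemma O_theta_simple_two_edges:
  fixes d :: "'l::monoid_mult \<Rightarrow> nat ^ 'k::{finite,linorder}" and s :: "'l \<Rightarrow> 'a::cstar_algebra"
  assumes kgraph: "single_vertex_kgraph d" and O: "is_O_theta d s"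
    and simple: "simple_cstar (UNIV :: 'a set)"
  shows "2 \<le> card (edges d i)"
proof (rule ccontr)
  interpret kgraph_isometries d s
    using kgraph O by (intro cuntz_representation_kgraph_isometries) (simp_all add: is_O_theta_def)
  assume "\<not> 2 \<le> card (edges d i)"
  then have "card (edges d i) = 1" using card_level_pos[of "unit_degree i"] by (simp add: edges_eq_level)
  then obtain e where e: "edges d i = {e}" by (rule card_1_singletonE)
  have U: "adj (s e) * s e = 1" "s e * adj (s e) = 1"
    using edge_orthonormal[of e i e] edge_complete[of i] e by simp_all
  obtain N where N: "N > 0" "\<And>j f. f \<in> edges d j \<Longrightarrow> s e ^ N * s f = s f * s e ^ N"
    using single_edge_power_commutes[OF e] by blast
  define W where "W = s e ^ N"
  have W: "adj W * W = 1" unfolding W_def by (rule isometry_power[OF U(1)])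
  have W': "W * adj W = 1"
    using isometry_power[of "adj (s e)" N] U by (simp add: W_def adj_adj adj_power)
  have "{x. W * x = x * W} = UNIV"
    using N(2) by (intro O_theta_generated[OF O commutant_of_unitary_subalgebra[OF W W']])
      (simp add: W_def)
  then have "W * x = x * W" for x by blast
  then obtain c where c: "W = c *\<^sub>C 1" using simple_central_unitary_scalar[OF simple W] by blast
  \<comment> \<open>The gauge parameter is chosen so that its \<open>N\<close>-th power is \<open>-1\<close>.\<close>
  define z where "z = cis (pi / real N)"
  have zN: "z ^ N = -1" using N(1) by (simp add: z_def Complex.DeMoivre)
  obtain h where h: "unital_star_hom h (whole :: 'a cstar)"
    and hs: "\<And>i e. e \<in> edges d i \<Longrightarrow> h (s e) = z *\<^sub>C s e"
    by (rule O_theta_gauge[OF kgraph O, of z]) (simp_all add: z_def)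
  have ring: "h \<in> ring_hom whole whole" and hC: "h (c *\<^sub>C x) = c *\<^sub>C h x" for c x
    using h by (simp_all add: unital_star_hom_def whole_def)
  have h_mult: "h (x * y) = h x * h y" for x y
    using ring_hom_mult[OF ring, of x y] by (simp add: whole_def)
  have h_one: "h 1 = 1" using ring_hom_one[OF ring] by (simp add: whole_def)
  have "h (s e ^ n) = (z ^ n) *\<^sub>C s e ^ n" for n
    using hs[of e i] e
    by (induction n) (simp_all add: h_one h_mult mult_scaleC_left mult_scaleC_right scaleC_scaleC mult.commute)
  then have "h W = - W" by (simp add: W_def zN)
  moreover have "h W = W" by (simp add: c hC h_one)
  ultimately have "W = - W" by simp
  then have "2 *\<^sub>R W = 0" by (simp add: scaleR_2 eq_neg_iff_add_eq_0)
  then have "W = 0" by simp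
  with W show False by simp
qed


section \<open>Averaging by unitaries of balanced matrix units\<close>

context kgraph_isometries
begin

lemma balanced_in_X0:
  assumes "d a = d b"
  shows "S a * adj (S b) \<in> X0 d s"
proof -
  obtain u v where uv: "set u \<subseteq> all_edges" "prod_list u = a" "set v \<subseteq> all_edges" "prod_list v = b"
    using word_exists by metis
  then have "S a * adj (S b) = gen_word s u * adj (gen_word s v)" by (simp add: gen_word_eq_S)
  with uv assms show ?thesis unfolding X0_def by (intro cspace.span_base) blast
qed

lemma ampliated_compress_in_Ave:
  assumes A: "unital_cstar_subalgebra A" and X0: "X0 d s \<subseteq> A"
  shows "(\<lambda>x. \<Sum>l\<in>level p. S l * compress p x * adj (S l)) \<in> Ave (unitaries A)"
  unfolding compress_def
proof (rule matrix_unit_average_in_Ave)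
  show "level p \<noteq> {}" using card_level_pos[of p] by auto
  show "cspace.subspace A" using A by (simp add: unital_cstar_subalgebra_def)
  show "S a * adj (S b) \<in> A" if "a \<in> level p" "b \<in> level p" for a b
    using that X0 balanced_in_X0[of a b] by (auto simp: level_def)
qed (simp_all add: finite_level level_orthonormal S_complete)

end

context pullback_isometries
begin

text \<open>The difference from the limit is the ampliation of \<open>compress (vec N) x - state x\<close>, and ampliation is
  contractive.\<close>

lemma averages_tendsto_state:
  "(\<lambda>N. \<Sum>l\<in>level (vec N). S l * compress (vec N) x * adj (S l)) \<longlonglongrightarrow> state x *\<^sub>C 1"
proof -
  have "(\<Sum>l\<in>level p. S l * y * adj (S l)) - c *\<^sub>C 1 = (\<Sum>l\<in>level p. S l * (y - c *\<^sub>C 1) * adj (S l))"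
    for p y c
  proof -
    have "(\<Sum>l\<in>level p. S l * (c *\<^sub>C 1) * adj (S l)) = c *\<^sub>C (\<Sum>l\<in>level p. S l * adj (S l))"
      by (simp add: mult_scaleC_left mult_scaleC_right cspace.scale_sum_right)
    then show ?thesis
      by (simp add: S_complete right_diff_distrib left_diff_distrib sum_subtractf)
  qed
  then have bound: "norm ((\<Sum>l\<in>level p. S l * y * adj (S l)) - c *\<^sub>C 1) \<le> norm (y - c *\<^sub>C 1)" for p y c
    using norm_ampliation_le[OF finite_level level_orthonormal, of p] by simp
  have "(\<lambda>N. norm (compress (vec N) x - state x *\<^sub>C 1)) \<longlonglongrightarrow> 0"
    using compress_tendsto_state[of x] by (simp add: LIM_zero tendsto_norm_zero)
  then have "(\<lambda>N. (\<Sum>l\<in>level (vec N). S l * compress (vec N) x * adj (S l)) - state x *\<^sub>C 1) \<longlonglongrightarrow> 0"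
    by (rule Lim_null_comparison[rotated]) (simp add: bound)
  then show ?thesis by (rule LIM_zero_cancel)
qed

lemma state_in_averages:
  assumes A: "unital_cstar_subalgebra A" and X0: "X0 d s \<subseteq> A"
  shows "state x *\<^sub>C 1 \<in> closure {\<alpha> x | \<alpha>. \<alpha> \<in> Ave (unitaries A)}"
proof -
  have "(\<Sum>l\<in>level (vec N). S l * compress (vec N) x * adj (S l)) \<in> {\<alpha> x | \<alpha>. \<alpha> \<in> Ave (unitaries A)}" for N
    unfolding mem_Collect_eq using ampliated_compress_in_Ave[OF assms, of "vec N"]
    by (intro exI[of _ "\<lambda>x. \<Sum>l\<in>level (vec N). S l * compress (vec N) x * adj (S l)"]) simp
  then show ?thesis unfolding closure_sequential
    by (intro exI[of _ "\<lambda>N. \<Sum>l\<in>level (vec N). S l * compress (vec N) x * adj (S l)"] conjI allI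
        averages_tendsto_state)
qed

end

section \<open>Simplicity and the Dixmier property\<close>

lemma closed_ideal_Ave:
  assumes J: "closed_ideal A J" and \<alpha>: "\<alpha> \<in> Ave (unitaries A)" and A: "unital_cstar_subalgebra A"
    and x: "x \<in> J"
  shows "\<alpha> x \<in> J"
proof -
  have sub: "cspace.subspace J" using J by (simp add: closed_ideal_def)
  have u: "u * x * adj u \<in> J" if "u \<in> unitaries A" for u
  proof -
    have "u \<in> A" "adj u \<in> A" using that A by (simp_all add: unitaries_def unital_cstar_subalgebra_def)
    then show ?thesis using J x by (simp add: closed_ideal_def)
  qed
  show ?thesis using \<alpha> u unfolding Ave_def
    by (auto simp: scaleR_scaleC intro!: cspace.subspace_sum[OF sub] cspace.subspace_scale[OF sub])
qed

theorem corollary4p7: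
  fixes d :: "'l::monoid_mult \<Rightarrow> nat ^ 'k::{finite,linorder}"
    and s :: "'l \<Rightarrow> 'a::cstar_algebra"
    and A :: "'a set"
  assumes "single_vertex_kgraph d"
    and O_theta: "is_O_theta d s"
    and aperiodic: "simple_cstar (UNIV :: 'a set)"
    and "little_pullback d"
    and "unital_cstar_subalgebra A"
    and "X0 d s \<subseteq> A"
  shows "simple_cstar A \<and> dixmier_property A"
proof -
  interpret kgraph_isometries d s
    using assms(1) O_theta by (intro cuntz_representation_kgraph_isometries) (simp_all add: is_O_theta_def)
  have "closure monomial_span = UNIV"
    using edge_in_monomial_span closure_subset
    by (intro O_theta_generated[OF O_theta closure_monomial_span_subalgebra]) blast
  then interpret pullback_isometries d s
    using assms(4) O_theta_simple_two_edges[OF assms(1) O_theta aperiodic]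
    by unfold_locales
  have sub: "cspace.subspace A" and one: "1 \<in> A" and adjA: "\<And>x. x \<in> A \<Longrightarrow> adj x \<in> A"
    using assms(5) by (simp_all add: unital_cstar_subalgebra_def)
  have scalar: "c *\<^sub>C 1 \<in> A" for c by (rule cspace.subspace_scale[OF sub one])
  have "J = {0} \<or> J = A" if J: "closed_ideal A J" for J
  proof (cases "J \<subseteq> {0}")
    case True
    moreover have "0 \<in> J" using J by (simp add: closed_ideal_def cspace.subspace_0)
    ultimately show ?thesis by blast
  next
    case False
    then obtain x where x: "x \<in> J" "x \<noteq> 0" by blast
    define c where "c = state (adj x * x)"
    have "c \<noteq> 0" using state_faithful[OF aperiodic] x(2) by (auto simp: c_def)
    have "x \<in> A" using J x(1) by (auto simp: closed_ideal_def)
    then have "adj x * x \<in> J" using J x(1) adjA by (simp add: closed_ideal_def)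
    then have "{\<alpha> (adj x * x) | \<alpha>. \<alpha> \<in> Ave (unitaries A)} \<subseteq> J"
      using closed_ideal_Ave[OF J _ assms(5)] by blast
    moreover have "closed J" using J by (simp add: closed_ideal_def)
    ultimately have "c *\<^sub>C 1 \<in> J"
      using state_in_averages[OF assms(5,6), of "adj x * x"] closure_minimal unfolding c_def by blast
    then have "inverse c *\<^sub>C (c *\<^sub>C 1) \<in> J" using J by (simp only: closed_ideal_def cspace.subspace_scale)
    then have "1 \<in> J" using \<open>c \<noteq> 0\<close> by (simp add: scaleC_scaleC)
    then have "a \<in> J" if "a \<in> A" for a using J that unfolding closed_ideal_def by (metis mult_1_right)
    then show ?thesis using J by (auto simp: closed_ideal_def)
  qed
  moreover have "A \<noteq> {0}" using one by auto
  ultimately have "simple_cstar A" by (simp add: simple_cstar_def)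
  moreover have "dixmier_property A" unfolding dixmier_property_def
  proof
    fix a
    have "state a *\<^sub>C 1 \<in> centre A" using scalar by (simp add: centre_def scalar_mult mult_scalar)
    with state_in_averages[OF assms(5,6), of a]
    show "closure {\<alpha> a |\<alpha>. \<alpha> \<in> Ave (unitaries A)} \<inter> centre A \<noteq> {}" by blast
  qed
  ultimately show ?thesis ..
qed

end
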